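(* Let $H_8$ be the unique nontrivial (neither commutative nor cocommutative) semisimple Hopf algebra of dimension $8$ over $k$, and let $Q$ be the quaternion group of order $8$. Then the Drinfeld double $D(H_8)$ has no quotient Hopf algebra isomorphic to the group algebra $kQ$.
   Context: $k$ is an algebraically closed field of characteristic zero. $H_8$ is generated as an algebra by $x,y,z$ with relations $x^2=y^2=1$, $xy=yx$, $zx=yz$, $zy=xz$, $z^2=\frac12(1+x+y-xy)$, and coalgebra structure $\Delta(x)=x\otimes x$, $\Delta(y)=y\otimes y$, $\Delta(z)=\frac12\left((1+y)\otimes1+(1-y)\otimes x\right)(z\otimes z)$, $\epsilon(x)=\epsilon(y)=\epsilon(z)=1$. *)

theory Defs
  imports
    "HOL-Analysis.Analysis"
    "HOL-Algebra.Group"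
    "HOL-Library.Poly_Mapping"
    "HOL-Computational_Algebra.Polynomial"
begin

section \<open>Tensor products of coordinate spaces\<close>

text \<open>
  A finite-dimensional vector space over a field is taken with a basis, that is, as \<open>'k ^ 'i\<close> for
  a finite type \<open>'i\<close>, with the linear maps \<^term>\<open>Vector_Spaces.linear (*s) (*s)\<close>.
  The tensor product of \<open>'k ^ 'i\<close> and \<open>'k ^ 'j\<close> is \<open>'k ^ ('i \<times> 'j)\<close>. The multiplication
  and the unit vector that the library puts on \<open>'k ^ 'i\<close> are componentwise and are not used.
\<close>

definition tensor :: "'k::field ^ 'i \<Rightarrow> 'k ^ 'j \<Rightarrow> 'k ^ ('i \<times> 'j)" where
  "tensor a b = (\<chi> p. a $ fst p * b $ snd p)"

text \<open>
  The linear map out of the tensor product that is induced by a bilinear map \<open>\<beta>\<close>. In Sweedler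
  notation, \<open>tlift \<beta> (\<Delta> h)\<close> is the sum of all \<open>\<beta> h\<^sub>(\<^sub>1\<^sub>) h\<^sub>(\<^sub>2\<^sub>)\<close>.
\<close>

definition tlift ::
  "('k::field ^ 'i \<Rightarrow> 'k ^ 'j \<Rightarrow> 'k ^ 'l) \<Rightarrow> 'k ^ ('i::finite \<times> 'j::finite) \<Rightarrow> 'k ^ 'l" where
  "tlift \<beta> t = (\<Sum>i\<in>UNIV. \<Sum>j\<in>UNIV. t $ (i, j) *s \<beta> (axis i 1) (axis j 1))"


section \<open>Finite-dimensional Hopf algebras\<close>

record ('k, 'i) hopf =
  hmult :: "'k ^ 'i \<Rightarrow> 'k ^ 'i \<Rightarrow> 'k ^ 'i"
  hunit :: "'k ^ 'i"
  comult :: "'k ^ 'i \<Rightarrow> 'k ^ ('i \<times> 'i)"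
  counit :: "'k ^ 'i \<Rightarrow> 'k"
  antipode :: "'k ^ 'i \<Rightarrow> 'k ^ 'i"

definition tensor_mult ::
  "('k::field, 'i::finite) hopf \<Rightarrow> 'k ^ ('i \<times> 'i) \<Rightarrow> 'k ^ ('i \<times> 'i) \<Rightarrow> 'k ^ ('i \<times> 'i)" where
  "tensor_mult H s t =
     tlift (\<lambda>a b. tlift (\<lambda>c d. tensor (hmult H a c) (hmult H b d)) t) s"

locale hopf_algebra =
  fixes H :: "('k::field, 'i::finite) hopf"
  assumes linear_mult_right: "Vector_Spaces.linear (*s) (*s) (hmult H a)"
    and linear_mult_left: "Vector_Spaces.linear (*s) (*s) (\<lambda>a. hmult H a b)"
    and mult_assoc: "hmult H (hmult H a b) c = hmult H a (hmult H b c)"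
    and unit_left: "hmult H (hunit H) a = a"
    and unit_right: "hmult H a (hunit H) = a"
    and linear_comult: "Vector_Spaces.linear (*s) (*s) (comult H)"
    and linear_counit: "Vector_Spaces.linear (*s) (*) (counit H)"
    and coassoc:
      "tlift (\<lambda>b c. tlift (\<lambda>b1 b2. tensor b1 (tensor b2 c)) (comult H b)) (comult H a)
       = tlift (\<lambda>b c. tensor b (comult H c)) (comult H a)"
    and counit_left: "tlift (\<lambda>b c. counit H b *s c) (comult H a) = a"
    and counit_right: "tlift (\<lambda>b c. counit H c *s b) (comult H a) = a"
    and comult_mult: "comult H (hmult H a b) = tensor_mult H (comult H a) (comult H b)"
    and comult_unit: "comult H (hunit H) = tensor (hunit H) (hunit H)"
    and counit_mult: "counit H (hmult H a b) = counit H a * counit H b"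
    and counit_unit: "counit H (hunit H) = 1"
    and linear_antipode: "Vector_Spaces.linear (*s) (*s) (antipode H)"
    and antipode_left:
      "tlift (\<lambda>b c. hmult H (antipode H b) c) (comult H a) = counit H a *s hunit H"
    and antipode_right:
      "tlift (\<lambda>b c. hmult H b (antipode H c)) (comult H a) = counit H a *s hunit H"

definition hopf_hom ::
  "('k::field, 'i::finite) hopf \<Rightarrow> ('k, 'j::finite) hopf \<Rightarrow> ('k ^ 'i \<Rightarrow> 'k ^ 'j) \<Rightarrow> bool" where
  "hopf_hom A B f \<longleftrightarrow>
     Vector_Spaces.linear (*s) (*s) f \<and>
     (\<forall>a b. f (hmult A a b) = hmult B (f a) (f b)) \<and>
     f (hunit A) = hunit B \<and>
     (\<forall>a. comult B (f a) = tlift (\<lambda>b c. tensor (f b) (f c)) (comult A a)) \<and>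
     (\<forall>a. counit B (f a) = counit A a) \<and>
     (\<forall>a. f (antipode A a) = antipode B (f a))"

definition hopf_isomorphic ::
  "('k::field, 'i::finite) hopf \<Rightarrow> ('k, 'j::finite) hopf \<Rightarrow> bool" where
  "hopf_isomorphic A B \<longleftrightarrow> (\<exists>f. hopf_hom A B f \<and> bij f)"

definition quotient_hopf_algebra ::
  "('k::field, 'i::finite) hopf \<Rightarrow> ('k, 'j::finite) hopf \<Rightarrow> bool" where
  "quotient_hopf_algebra A B \<longleftrightarrow> hopf_algebra B \<and> (\<exists>p. hopf_hom A B p \<and> surj p)"


section \<open>The Drinfeld double\<close>

definition pairing :: "'k::field ^ 'i::finite \<Rightarrow> 'k ^ 'i \<Rightarrow> 'k" where
  "pairing f a = (\<Sum>i\<in>UNIV. f $ i * a $ i)"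

text \<open>
  The dual space has the dual basis, so that \<open>f :: 'k ^ 'i\<close> stands for the linear form
  \<^term>\<open>pairing f\<close>, and the linear form \<open>\<phi>\<close> is represented by \<open>covector \<phi>\<close>.
\<close>

definition covector :: "('k::field ^ 'i::finite \<Rightarrow> 'k) \<Rightarrow> 'k ^ 'i" where
  "covector \<phi> = (\<chi> i. \<phi> (axis i 1))"

definition dual_hopf :: "('k::field, 'i::finite) hopf \<Rightarrow> ('k, 'i) hopf" where
  "dual_hopf H =
     \<lparr>hmult = (\<lambda>f g. covector (\<lambda>a. pairing (tensor f g) (comult H a))),
      hunit = covector (counit H),
      comult = (\<lambda>f. \<chi> p. pairing f (hmult H (axis (fst p) 1) (axis (snd p) 1))),
      counit = (\<lambda>f. pairing f (hunit H)),
      antipode = (\<lambda>f. covector (\<lambda>a. pairing f (antipode H a)))\<rparr>"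

definition cop_hopf :: "('k::field, 'i::finite) hopf \<Rightarrow> ('k, 'i) hopf" where
  "cop_hopf H =
     \<lparr>hmult = hmult H,
      hunit = hunit H,
      comult = (\<lambda>a. \<chi> p. comult H a $ (snd p, fst p)),
      counit = counit H,
      antipode = inv_into UNIV (antipode H)\<rparr>"

text \<open>
  The product of \<open>f \<otimes> h\<close> and \<open>g \<otimes> l\<close> in the double is
  \<open>f \<cdot> g(S\<inverse>(h\<^sub>(\<^sub>3\<^sub>)) ? h\<^sub>(\<^sub>1\<^sub>)) \<otimes> h\<^sub>(\<^sub>2\<^sub>) l\<close>, summed over the twofold coproduct of \<open>h\<close>.
\<close>

definition double_mult ::
  "('k::field, 'i::finite) hopf \<Rightarrow> 'k ^ 'i \<Rightarrow> 'k ^ 'i \<Rightarrow> 'k ^ 'i \<Rightarrow> 'k ^ 'i \<Rightarrow> 'k ^ ('i \<times> 'i)" where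
  "double_mult H f h g l =
     tlift (\<lambda>h1 h23.
       tlift (\<lambda>h2 h3.
         tensor
           (hmult (dual_hopf H) f
             (covector (\<lambda>a. pairing g (hmult H (hmult H (inv_into UNIV (antipode H) h3) a) h1))))
           (hmult H h2 l))
         (comult H h23))
       (comult H h)"

text \<open>
  The double has the underlying coalgebra \<open>(H\<^sup>*)\<^sup>c\<^sup>o\<^sup>p \<otimes> H\<close>, and contains
  \<open>(H\<^sup>*)\<^sup>c\<^sup>o\<^sup>p\<close> and \<open>H\<close> as Hopf subalgebras.
\<close>

definition drinfeld_double :: "('k::field, 'i::finite) hopf \<Rightarrow> ('k, 'i \<times> 'i) hopf" where
  "drinfeld_double H =
     (let A = cop_hopf (dual_hopf H) in
     \<lparr>hmult = (\<lambda>s t. tlift (\<lambda>f h. tlift (\<lambda>g l. double_mult H f h g l) t) s),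
      hunit = tensor (hunit A) (hunit H),
      comult = tlift (\<lambda>f h.
        tlift (\<lambda>f1 f2.
          tlift (\<lambda>h1 h2. tensor (tensor f1 h1) (tensor f2 h2))
            (comult H h))
          (comult A f)),
      counit = (\<lambda>t. \<Sum>i\<in>UNIV. \<Sum>j\<in>UNIV. t $ (i, j) * (counit A (axis i 1) * counit H (axis j 1))),
      antipode = tlift (\<lambda>f h. double_mult H (hunit A) (antipode H h) (antipode A f) (hunit H))\<rparr>)"


section \<open>Algebras presented by generators and relations\<close>

text \<open>
  \<open>'g word\<close> is the free monoid on \<open>'g\<close>. It is written additively, because
  \<open>'g word \<Rightarrow>\<^sub>0 'k\<close>, with the convolution product of the library, is then the free
  \<open>'k\<close>-algebra on \<open>'g\<close>.
\<close>

datatype 'g word = Word (letters: "'g list")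

instantiation word :: (type) monoid_add
begin

definition zero_word :: "'a word" where
  "zero_word = Word []"

definition plus_word :: "'a word \<Rightarrow> 'a word \<Rightarrow> 'a word" where
  "plus_word u v = Word (letters u @ letters v)"

instance
  by standard (simp_all add: zero_word_def plus_word_def)

end

definition gen :: "'g \<Rightarrow> 'g word \<Rightarrow>\<^sub>0 'k::field" where
  "gen x = Poly_Mapping.single (Word [x]) 1"

definition eval_free ::
  "('k::field, 'i::finite) hopf \<Rightarrow> ('g \<Rightarrow> 'k ^ 'i) \<Rightarrow> ('g word \<Rightarrow>\<^sub>0 'k) \<Rightarrow> 'k ^ 'i" where
  "eval_free H v p =
     (\<Sum>w\<in>Poly_Mapping.keys p.
        Poly_Mapping.lookup p w *s foldr (\<lambda>x. hmult H (v x)) (letters w) (hunit H))"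

definition two_sided_ideal :: "'r::ring_1 set \<Rightarrow> bool" where
  "two_sided_ideal I \<longleftrightarrow>
     0 \<in> I \<and> (\<forall>a\<in>I. \<forall>b\<in>I. a + b \<in> I) \<and> (\<forall>a\<in>I. \<forall>r. r * a \<in> I \<and> a * r \<in> I)"

text \<open>
  Evaluation at \<open>v\<close> induces an isomorphism of the free algebra modulo the two-sided ideal
  generated by \<open>R\<close> onto the algebra \<open>H\<close>.
\<close>

definition presented_by ::
  "('k::field, 'i::finite) hopf \<Rightarrow> ('g \<Rightarrow> 'k ^ 'i) \<Rightarrow> ('g word \<Rightarrow>\<^sub>0 'k) set \<Rightarrow> bool" where
  "presented_by H v R \<longleftrightarrow>
     surj (eval_free H v) \<and> {p. eval_free H v p = 0} = two_sided_ideal hull R"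


section \<open>The Hopf algebra of dimension eight\<close>

datatype h8_gen = Gx | Gy | Gz

definition h8_relations :: "(h8_gen word \<Rightarrow>\<^sub>0 'k::field) set" where
  "h8_relations =
     {gen Gx * gen Gx - 1,
      gen Gy * gen Gy - 1,
      gen Gx * gen Gy - gen Gy * gen Gx,
      gen Gz * gen Gx - gen Gy * gen Gz,
      gen Gz * gen Gy - gen Gx * gen Gz,
      gen Gz * gen Gz - Poly_Mapping.single 0 (1 / 2) * (1 + gen Gx + gen Gy - gen Gx * gen Gy)}"

text \<open>
  The antipode is not mentioned, as it is determined by the bialgebra structure.
\<close>

definition is_H8 :: "('k::field, 'i::finite) hopf \<Rightarrow> bool" where
  "is_H8 H \<longleftrightarrow>
     hopf_algebra H \<and>
     (\<exists>v. presented_by H v h8_relations \<and>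
       (let x = v Gx; y = v Gy; z = v Gz; e = hunit H in
         comult H x = tensor x x \<and>
         comult H y = tensor y y \<and>
         comult H z =
           (1 / 2) *s tensor_mult H (tensor (e + y) e + tensor (e - y) x) (tensor z z) \<and>
         counit H x = 1 \<and> counit H y = 1 \<and> counit H z = 1))"


section \<open>The group algebra of the quaternion group\<close>

text \<open>
  The carrier of \<open>G\<close> has to be the whole type.
\<close>

definition group_algebra :: "'g::finite monoid \<Rightarrow> ('k::field, 'g) hopf" where
  "group_algebra G =
     \<lparr>hmult = (\<lambda>a b. \<Sum>g\<in>UNIV. \<Sum>h\<in>UNIV. (a $ g * b $ h) *s axis (g \<otimes>\<^bsub>G\<^esub> h) 1),
      hunit = axis \<one>\<^bsub>G\<^esub> 1,
      comult = (\<lambda>a. \<Sum>g\<in>UNIV. a $ g *s tensor (axis g 1) (axis g 1)),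
      counit = (\<lambda>a. \<Sum>g\<in>UNIV. a $ g),
      antipode = (\<lambda>a. \<Sum>g\<in>UNIV. a $ g *s axis (inv\<^bsub>G\<^esub> g) 1)\<rparr>"

text \<open>
  An element of the quaternion group \<open>{\<plusminus>1, \<plusminus>i, \<plusminus>j, \<plusminus>k}\<close> is a pair of a sign, with
  \<^const>\<open>True\<close> for minus, and a unit.
\<close>

datatype quat_unit = Q1 | Qi | Qj | Qk

instance quat_unit :: finite
proof
  have "(UNIV :: quat_unit set) = {Q1, Qi, Qj, Qk}"
    using quat_unit.exhaust by auto
  then show "finite (UNIV :: quat_unit set)"
    by (metis finite.emptyI finite_insert)
qed

type_synonym q8 = "bool \<times> quat_unit"

fun quat_unit_mult :: "quat_unit \<Rightarrow> quat_unit \<Rightarrow> q8" where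
  "quat_unit_mult Q1 u = (False, u)"
| "quat_unit_mult u Q1 = (False, u)"
| "quat_unit_mult Qi Qi = (True, Q1)"
| "quat_unit_mult Qj Qj = (True, Q1)"
| "quat_unit_mult Qk Qk = (True, Q1)"
| "quat_unit_mult Qi Qj = (False, Qk)"
| "quat_unit_mult Qj Qk = (False, Qi)"
| "quat_unit_mult Qk Qi = (False, Qj)"
| "quat_unit_mult Qj Qi = (True, Qk)"
| "quat_unit_mult Qk Qj = (True, Qi)"
| "quat_unit_mult Qi Qk = (True, Qj)"

definition q8_mult :: "q8 \<Rightarrow> q8 \<Rightarrow> q8" where
  "q8_mult a b =
     (let c = quat_unit_mult (snd a) (snd b) in ((fst a \<noteq> fst b) \<noteq> fst c, snd c))"

definition Q8 :: "q8 monoid" where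
  "Q8 = \<lparr>carrier = UNIV, mult = q8_mult, one = (False, Q1)\<rparr>"

lemma q8_mult_assoc: "q8_mult (q8_mult a b) c = q8_mult a (q8_mult b c)"
  by (cases "snd a"; cases "snd b"; cases "snd c") (auto simp: q8_mult_def Let_def)

lemma group_Q8: "group Q8"
proof (rule groupI)
  fix a :: q8
  have "q8_mult (fst a \<noteq> (snd a \<noteq> Q1), snd a) a = (False, Q1)"
    by (cases "snd a") (auto simp: q8_mult_def Let_def)
  then show "\<exists>b\<in>carrier Q8. b \<otimes>\<^bsub>Q8\<^esub> a = \<one>\<^bsub>Q8\<^esub>"
    by (auto simp: Q8_def)
qed (auto simp: Q8_def q8_mult_assoc, auto simp: q8_mult_def)

end

theory Submission
  imports Defs
begin

text \<open>
  A Hopf algebra map from the double to \<open>kQ\<close> is determined by its restrictions to \<open>H\<close> and to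
  \<open>(H\<^sup>*)\<^sup>c\<^sup>o\<^sup>p\<close>, since the double is the product of these two subalgebras. Both images lie in
  the span of the central elements \<open>\<plusminus>1\<close>, so the map is not onto.

  On \<open>H\<close>, the grouplikes \<open>x\<close> and \<open>y\<close> go to involutions of \<open>Q\<close>, which are \<open>\<plusminus>1\<close>; cocommutativity
  of \<open>kQ\<close> and the relations for \<open>z\<close> then confine the image of \<open>z\<close>.

  A map \<open>f \<mapsto> \<Sum>\<^sub>g f(r\<^sub>g) g\<close> on the dual is a family of orthogonal idempotents \<open>r\<^sub>g\<close> of \<open>H\<close> with
  \<open>\<Delta> r\<^sub>g = \<Sum>\<^sub>a\<^sub>b\<^sub>=\<^sub>g r\<^sub>a \<otimes> r\<^sub>b\<close>. The four characters of \<open>H\<close> have order at most two under convolution, so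
  they vanish on \<open>r\<^sub>g\<close> for \<open>g \<noteq> \<plusminus>1\<close>. The tensor square of the two-dimensional representation \<open>\<sigma>\<close> is a
  sum of characters; if \<open>\<sigma>(r\<^sub>g) \<noteq> 0\<close> with \<open>g \<noteq> \<plusminus>1\<close>, this forces \<open>\<sigma>(r\<^sub>g) + \<sigma>(r\<^sub>-\<^sub>g) = 1\<close> and contradicts the
  explicit form of \<open>(\<sigma> \<otimes> \<sigma>)(r\<^sub>1)\<close>. The five representations together are faithful.
\<close>

section \<open>Multilinear maps in coordinates\<close>

abbreviation lin :: "('k::field ^ 'i \<Rightarrow> 'k ^ 'j) \<Rightarrow> bool" where
  "lin \<equiv> Vector_Spaces.linear (*s) (*s)"

definition bilin :: "('k::field ^ 'i \<Rightarrow> 'k ^ 'j \<Rightarrow> 'k ^ 'l) \<Rightarrow> bool" where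
  "bilin \<beta> \<longleftrightarrow> (\<forall>a. lin (\<beta> a)) \<and> (\<forall>b. lin (\<lambda>a. \<beta> a b))"

lemma linI:
  assumes "\<And>x y. f (x + y) = f x + f y" and "\<And>c x. f (c *s x) = c *s f x"
  shows "lin f"
  unfolding Vector_Spaces.linear_iff
  by (intro conjI allI assms vec.vector_space_axioms)

lemma lin_add: "lin f \<Longrightarrow> f (x + y) = f x + f y"
  and lin_diff: "lin f \<Longrightarrow> f (x - y) = f x - f y"
  and lin_scale: "lin f \<Longrightarrow> f (c *s x) = c *s f x"
  and lin_zero: "lin f \<Longrightarrow> f 0 = 0"
  and lin_sum: "lin f \<Longrightarrow> f (sum g A) = (\<Sum>a\<in>A. f (g a))"
  by (rule vec.linear_add vec.linear_diff vec.linear_scale vec.linear_0 vec.linear_sum;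
      assumption)+

lemma linear_form_add: "Vector_Spaces.linear (*s) (*) \<phi> \<Longrightarrow> \<phi> (x + y) = \<phi> x + \<phi> y"
  and linear_form_scale: "Vector_Spaces.linear (*s) (*) \<phi> \<Longrightarrow> \<phi> (c *s x) = c * \<phi> x"
  by (simp_all add: Vector_Spaces.linear_iff)

lemma bilinI:
  assumes "\<And>a b c. \<beta> a (b + c) = \<beta> a b + \<beta> a c" "\<And>a b c. \<beta> (a + b) c = \<beta> a c + \<beta> b c"
    and "\<And>a b k. \<beta> a (k *s b) = k *s \<beta> a b" "\<And>a b k. \<beta> (k *s a) b = k *s \<beta> a b"
  shows "bilin \<beta>"
  unfolding bilin_def by (intro conjI allI linI assms)

lemma lin_expand:
  fixes a :: "'k::field ^ 'i::finite"
  assumes "lin f" shows "f a = (\<Sum>i\<in>UNIV. a $ i *s f (axis i 1))"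
  by (subst basis_expansion[symmetric]) (simp add: lin_sum[OF assms] lin_scale[OF assms])

lemma linear_form_expand:
  fixes a :: "'k::field ^ 'i::finite"
  assumes "Vector_Spaces.linear (*s) (*) \<phi>" shows "\<phi> a = (\<Sum>i\<in>UNIV. a $ i * \<phi> (axis i 1))"
proof -
  have z: "\<phi> 0 = 0" using linear_form_scale[OF assms, of 0 0] by simp
  have "\<phi> (sum g A) = (\<Sum>a\<in>A. \<phi> (g a))" if "finite A" for g :: "'i \<Rightarrow> 'k ^ 'i" and A
    using that by induction (simp_all add: z linear_form_add[OF assms])
  then show ?thesis
    by (subst basis_expansion[symmetric]) (simp add: linear_form_scale[OF assms])
qed

lemma tensor_nth [simp]: "tensor a b $ (i, j) = a $ i * b $ j"
  by (simp add: tensor_def)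

lemma tensor_simps [simp]:
  "tensor (a + b) c = tensor a c + tensor b c" "tensor a (b + c) = tensor a b + tensor a c"
  "tensor (k *s a) c = k *s tensor a c" "tensor a (k *s c) = k *s tensor a c"
  by (simp_all add: vec_eq_iff tensor_def algebra_simps)

lemma tlift_simps [simp]:
  "tlift \<beta> (s + t) = tlift \<beta> s + tlift \<beta> t" "tlift \<beta> (k *s s) = k *s tlift \<beta> s"
  by (simp_all add: tlift_def vec.scale_left_distrib sum.distrib vec.scale_sum_right)

lemma tlift_lin: "lin (tlift \<beta>)"
  by (rule linI) simp_all

lemma lin_tlift:
  assumes "lin f" shows "f (tlift \<beta> t) = tlift (\<lambda>a b. f (\<beta> a b)) t"
  by (simp add: tlift_def lin_sum[OF assms] lin_scale[OF assms])

lemma tlift_add_fun: "tlift (\<lambda>a b. \<beta> a b + \<gamma> a b) t = tlift \<beta> t + tlift \<gamma> t"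
  by (simp add: tlift_def vec.scale_right_distrib sum.distrib)

lemma tlift_scale_fun: "tlift (\<lambda>a b. k *s \<beta> a b) t = k *s tlift \<beta> t"
  by (rule lin_tlift[symmetric], rule linI) (simp_all add: vec.scale_right_distrib mult.commute)

text \<open>\<open>tlift\<close> is defined through coordinates; this is the universal property of
  the tensor product. It evaluates a Sweedler expression once the coproduct is written as a sum of
  pure tensors.\<close>

lemma tlift_tensor:
  assumes "bilin \<beta>" shows "tlift \<beta> (tensor a b) = \<beta> a b"
proof -
  have l: "lin (\<beta> u)" "lin (\<lambda>a. \<beta> a v)" for u v
    using assms by (simp_all add: bilin_def)
  have "\<beta> a b = (\<Sum>i\<in>UNIV. a $ i *s \<beta> (axis i 1) b)" by (rule lin_expand[OF l(2)])
  also have "\<dots> = (\<Sum>i\<in>UNIV. \<Sum>j\<in>UNIV. (a $ i * b $ j) *s \<beta> (axis i 1) (axis j 1))"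
    by (subst lin_expand[OF l(1)]) (simp add: vec.scale_sum_right)
  finally show ?thesis by (simp add: tlift_def)
qed

lemma tlift_nth:
  "tlift \<beta> t $ l = (\<Sum>i\<in>UNIV. \<Sum>j\<in>UNIV. t $ (i, j) * \<beta> (axis i 1) (axis j 1) $ l)"
  by (simp add: tlift_def)

lemma tensor_axis: "tensor (axis i 1) (axis j 1) = axis (i, j) 1"
  by (auto simp: vec_eq_iff axis_def)

lemma tlift_tensor_id [simp]: "tlift tensor t = t"
proof -
  have "tlift tensor t = (\<Sum>p\<in>UNIV. t $ p *s axis p 1)"
    by (simp add: tlift_def tensor_axis sum.cartesian_product)
  then show ?thesis by (simp only: basis_expansion)
qed

lemma pairing_simps [simp]:
  "pairing (f + g) a = pairing f a + pairing g a" "pairing f (a + b) = pairing f a + pairing f b"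
  "pairing (k *s f) a = k * pairing f a" "pairing f (k *s a) = k * pairing f a"
  "pairing f 0 = 0" "pairing 0 a = 0"
  "pairing (f - g) a = pairing f a - pairing g a" "pairing f (a - b) = pairing f a - pairing f b"
  by (simp_all add: pairing_def algebra_simps sum.distrib sum_distrib_left sum_subtractf)

lemma pairing_sum: "pairing f (sum g A) = (\<Sum>a\<in>A. pairing f (g a))"
  by (induction A rule: infinite_finite_induct) simp_all

lemma pairing_axis [simp]: "pairing (axis i 1) a = a $ i" "pairing f (axis i 1) = f $ i"
  by (simp_all add: pairing_def axis_def if_distrib if_distribR cong: if_cong)

lemma pairing_eqI: "(\<And>f. pairing f a = pairing f b) \<Longrightarrow> a = b"
  by (metis pairing_axis(1) vec_eq_iff)

lemma pairing_tensor: "pairing (tensor f g) (tensor a b) = pairing f a * pairing g b"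
  by (simp add: pairing_def UNIV_Times_UNIV[symmetric] sum.cartesian_product'
      sum_product mult_ac del: UNIV_Times_UNIV)

lemma pairing_covector:
  assumes "Vector_Spaces.linear (*s) (*) \<phi>" shows "pairing (covector \<phi>) a = \<phi> a"
  by (simp add: linear_form_expand[OF assms, of a] pairing_def covector_def mult.commute)

lemma covector_pairing [simp]: "covector (pairing f) = f"
  by (simp add: covector_def vec_eq_iff)

section \<open>Presented algebras\<close>

lemma poly_mapping_induct [case_names zero single add]:
  fixes p :: "'w \<Rightarrow>\<^sub>0 'c::comm_monoid_add"
  assumes "P 0" "\<And>w c. P (Poly_Mapping.single w c)" "\<And>p q. P p \<Longrightarrow> P q \<Longrightarrow> P (p + q)"
  shows "P p"
proof (induction p rule: Poly_Mapping.update_induct)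
  case const
  show ?case by (rule assms(1))
next
  case (update f a b)
  \<comment> \<open>The induction rule takes \<open>a\<close> outside the support of
    \<open>f\<close>, so updating there amounts to adding a monomial.\<close>
  have "Poly_Mapping.update a b f = f + Poly_Mapping.single a b"
    using update(1) by (intro poly_mapping_eqI)
      (auto simp: lookup_update lookup_add lookup_single when_def in_keys_iff)
  then show ?case using update assms(2,3) by simp
qed

text \<open>Only the algebra half of the record is constrained, so that evaluation of free-algebra
  elements is available for \<open>matrix_algebra\<close> as well as for Hopf algebras.\<close>

locale unital_algebra =
  fixes H :: "('k::field, 'i::finite) hopf"
  assumes lin_mult_right: "lin (hmult H a)"
    and lin_mult_left: "lin (\<lambda>a. hmult H a b)"
    and hmult_assoc: "hmult H (hmult H a b) c = hmult H a (hmult H b c)"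
    and hunit_left [simp]: "hmult H (hunit H) a = a"
    and hunit_right [simp]: "hmult H a (hunit H) = a"
begin

lemma mult_simps [simp]:
  "hmult H a (b + c) = hmult H a b + hmult H a c"
  "hmult H (a + b) c = hmult H a c + hmult H b c"
  "hmult H a (b - c) = hmult H a b - hmult H a c"
  "hmult H (a - b) c = hmult H a c - hmult H b c"
  "hmult H a (k *s b) = k *s hmult H a b"
  "hmult H (k *s a) b = k *s hmult H a b"
  "hmult H a 0 = 0" "hmult H 0 b = 0"
  by (rule lin_mult_right[THEN lin_add] lin_mult_left[THEN lin_add] lin_mult_right[THEN lin_diff]
      lin_mult_left[THEN lin_diff] lin_mult_right[THEN lin_scale] lin_mult_left[THEN lin_scale]
      lin_mult_right[THEN lin_zero] lin_mult_left[THEN lin_zero])+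

definition word_value :: "('g \<Rightarrow> 'k ^ 'i) \<Rightarrow> 'g word \<Rightarrow> 'k ^ 'i" where
  "word_value v w = foldr (\<lambda>x. hmult H (v x)) (letters w) (hunit H)"

lemma word_value_add: "word_value v (u + w) = hmult H (word_value v u) (word_value v w)"
proof -
  have "foldr (\<lambda>x. hmult H (v x)) (xs @ ys) (hunit H)
      = hmult H (foldr (\<lambda>x. hmult H (v x)) xs (hunit H)) (foldr (\<lambda>x. hmult H (v x)) ys (hunit H))"
    for xs ys
    by (induction xs) (simp_all add: hmult_assoc)
  then show ?thesis by (simp add: word_value_def plus_word_def)
qed

lemma word_value_zero: "word_value v 0 = hunit H"
  by (simp add: word_value_def zero_word_def)

text \<open>The sum defining \<open>eval_free\<close> runs over a support that varies with
  \<open>p\<close>; over a common finite superset, additivity can be checked termwise.\<close>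

lemma eval_free_superset:
  assumes "finite A" "Poly_Mapping.keys p \<subseteq> A"
  shows "eval_free H v p = (\<Sum>w\<in>A. Poly_Mapping.lookup p w *s word_value v w)"
  unfolding eval_free_def word_value_def
  by (rule sum.mono_neutral_left) (use assms in \<open>auto simp: in_keys_iff\<close>)

lemma eval_free_add: "eval_free H v (p + q) = eval_free H v p + eval_free H v q"
proof -
  let ?A = "Poly_Mapping.keys p \<union> Poly_Mapping.keys q"
  have "Poly_Mapping.keys (p + q) \<subseteq> ?A" by (rule Poly_Mapping.keys_add)
  then show ?thesis
    by (simp add: eval_free_superset[of ?A] Poly_Mapping.lookup_add vec.scale_left_distrib sum.distrib)
qed

lemma eval_free_single: "eval_free H v (Poly_Mapping.single w c) = c *s word_value v w"
  by (subst eval_free_superset[of "{w}"]) simp_all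

lemma eval_free_zero: "eval_free H v 0 = 0"
  by (simp add: eval_free_def)

lemma eval_free_mult: "eval_free H v (p * q) = hmult H (eval_free H v p) (eval_free H v q)"
proof -
  have single_mult: "eval_free H v (Poly_Mapping.single w c * q)
      = hmult H (eval_free H v (Poly_Mapping.single w c)) (eval_free H v q)" for w c q
  proof (induction q rule: poly_mapping_induct)
    case zero
    show ?case by (simp add: eval_free_zero)
  next
    case (single k a)
    show ?case by (simp add: mult_single eval_free_single word_value_add mult.commute)
  next
    case (add p q)
    then show ?case by (simp add: distrib_left eval_free_add)
  qed
  show ?thesis
  proof (induction p rule: poly_mapping_induct)
    case zero
    show ?case by (simp add: eval_free_zero)
  next
    case (single k a)
    show ?case by (rule single_mult)
  next
    case (add p q)
    then show ?case by (simp add: distrib_right eval_free_add)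
  qed
qed

lemma eval_free_scalar: "eval_free H v (Poly_Mapping.single 0 c) = c *s hunit H"
  by (simp add: eval_free_single word_value_zero)

lemma eval_free_one: "eval_free H v 1 = hunit H"
  using eval_free_scalar[of v 1] by simp

lemma eval_free_diff: "eval_free H v (p - q) = eval_free H v p - eval_free H v q"
  using eval_free_add[of v "p - q" q] by (simp add: algebra_simps)

lemma eval_free_gen: "eval_free H v (gen x) = v x"
  by (simp add: gen_def eval_free_single word_value_def)

lemmas eval_free_simps = eval_free_add eval_free_diff eval_free_mult eval_free_zero eval_free_one
  eval_free_scalar eval_free_gen

lemma eval_free_kernel_ideal: "two_sided_ideal {p. eval_free H v p = 0}"
  by (simp add: two_sided_ideal_def eval_free_simps)

end

text \<open>Pure tensors span, because \<open>tlift tensor\<close> is the identity. An identity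
  linear in a tensor thus needs a check on pure tensors only.\<close>

lemma tensor_induct [case_names zero add scale tensor]:
  fixes t :: "'k::field ^ ('i::finite \<times> 'j::finite)"
  assumes "P 0" "\<And>s t. P s \<Longrightarrow> P t \<Longrightarrow> P (s + t)" "\<And>k t. P t \<Longrightarrow> P (k *s t)"
    and "\<And>a b. P (tensor a b)"
  shows "P t"
proof -
  have sum: "P (sum f A)" if "\<And>a. a \<in> A \<Longrightarrow> P (f a)" "finite A"
    for f :: "'m \<Rightarrow> 'k ^ ('i \<times> 'j)" and A
    using that(2,1) by (induction A) (simp_all add: assms(1,2))
  have "P (tlift tensor t)"
    unfolding tlift_def by (intro sum assms(3,4) finite)
  then show ?thesis by simp
qed

section \<open>Consequences of the Hopf algebra axioms\<close>

sublocale hopf_algebra \<subseteq> unital_algebra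
  by (intro unital_algebra.intro linear_mult_right linear_mult_left mult_assoc unit_left unit_right)

lemma dual_unit: "hunit (dual_hopf H) = covector (counit H)"
  by (simp add: dual_hopf_def)

context hopf_algebra
begin

lemma comult_simps [simp]:
  "comult H (a + b) = comult H a + comult H b" "comult H (k *s a) = k *s comult H a"
  by (rule lin_add[OF linear_comult] lin_scale[OF linear_comult])+

lemma counit_simps [simp]:
  "counit H (a + b) = counit H a + counit H b" "counit H (k *s a) = k * counit H a"
  by (rule linear_form_add[OF linear_counit] linear_form_scale[OF linear_counit])+

lemma antipode_simps [simp]:
  "antipode H (a + b) = antipode H a + antipode H b" "antipode H (k *s a) = k *s antipode H a"
  by (rule lin_add[OF linear_antipode] lin_scale[OF linear_antipode])+

lemma pairing_counit [simp]: "pairing (covector (counit H)) a = counit H a"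
  by (rule pairing_covector[OF linear_counit])

lemma pairing_dual_mult:
  "pairing (hmult (dual_hopf H) f g) a = pairing (tensor f g) (comult H a)"
  by (simp add: dual_hopf_def, rule pairing_covector)
    (simp add: Vector_Spaces.linear_iff vec.vector_space_axioms
      vector_space_over_itself.vector_space_axioms)

lemma dual_mult_simps [simp]:
  "hmult (dual_hopf H) (a + b) c = hmult (dual_hopf H) a c + hmult (dual_hopf H) b c"
  "hmult (dual_hopf H) a (b + c) = hmult (dual_hopf H) a b + hmult (dual_hopf H) a c"
  "hmult (dual_hopf H) (k *s a) c = k *s hmult (dual_hopf H) a c"
  "hmult (dual_hopf H) a (k *s c) = k *s hmult (dual_hopf H) a c"
  by (simp_all add: dual_hopf_def covector_def vec_eq_iff)

lemma dual_unit_right [simp]: "hmult (dual_hopf H) f (covector (counit H)) = f"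
proof -
  have "pairing (tensor f (covector (counit H))) t = pairing f (tlift (\<lambda>b c. counit H c *s b) t)"
    for t
  proof (induction t rule: tensor_induct)
    case (tensor a b)
    have "bilin (\<lambda>(b :: 'k ^ 'i) c. counit H c *s b)"
      by (rule bilinI) (simp_all add: vec.scale_right_distrib vec.scale_left_distrib mult.commute)
    from tlift_tensor[OF this] show ?case by (simp add: pairing_tensor)
  qed (simp_all add: lin_zero[OF tlift_lin])
  then have "hmult (dual_hopf H) f (covector (counit H)) $ i = f $ i" for i
    by (metis pairing_axis(2) pairing_dual_mult counit_right)
  then show ?thesis by (simp add: vec_eq_iff)
qed

lemma tensor_mult_tensor: "tensor_mult H (tensor a b) (tensor c d) = tensor (hmult H a c) (hmult H b d)"
proof -
  have "bilin (\<lambda>c d. tensor (hmult H a c) (hmult H b d))" for a b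
    by (rule bilinI) simp_all
  note 1 = tlift_tensor[OF this]
  have "bilin (\<lambda>a b. tlift (\<lambda>c d. tensor (hmult H a c) (hmult H b d)) (tensor c d))"
    by (rule bilinI) (simp_all add: 1 tlift_add_fun tlift_scale_fun)
  from tlift_tensor[OF this] show ?thesis by (simp add: tensor_mult_def 1)
qed

lemma tensor_mult_simps [simp]:
  "tensor_mult H (s + s') t = tensor_mult H s t + tensor_mult H s' t"
  "tensor_mult H s (t + t') = tensor_mult H s t + tensor_mult H s t'"
  "tensor_mult H (k *s s) t = k *s tensor_mult H s t"
  "tensor_mult H s (k *s t) = k *s tensor_mult H s t"
  "tensor_mult H 0 t = 0" "tensor_mult H s 0 = 0"
proof -
  show 1: "tensor_mult H (s + s') t = tensor_mult H s t + tensor_mult H s' t"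
    "tensor_mult H (k *s s) t = k *s tensor_mult H s t"
    by (simp_all add: tensor_mult_def)
  show 2: "tensor_mult H s (t + t') = tensor_mult H s t + tensor_mult H s t'"
    by (simp add: tensor_mult_def tlift_add_fun)
  show 3: "tensor_mult H s (k *s t) = k *s tensor_mult H s t"
    by (simp add: tensor_mult_def tlift_scale_fun)
  show "tensor_mult H 0 t = 0" by (simp add: tensor_mult_def lin_zero[OF tlift_lin])
  show "tensor_mult H s 0 = 0"
    by (simp add: tensor_mult_def lin_zero[OF tlift_lin]) (simp add: tlift_def)
qed

lemma tensor_mult_diff:
  "tensor_mult H s (t - t') = tensor_mult H s t - tensor_mult H s t'"
  "tensor_mult H (s - s') t = tensor_mult H s t - tensor_mult H s' t"
  by (metis add_diff_cancel_right' diff_add_cancel tensor_mult_simps(2))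
    (metis add_diff_cancel_right' diff_add_cancel tensor_mult_simps(1))

end

section \<open>Matrix representations\<close>

text \<open>A representation is given by its matrix coefficients, as elements of the dual space.\<close>

definition rep :: "('k::field, 'i::finite) hopf \<Rightarrow> ('n::finite \<Rightarrow> 'n \<Rightarrow> 'k ^ 'i) \<Rightarrow> bool" where
  "rep H R \<longleftrightarrow>
     (\<forall>i j a b. pairing (R i j) (hmult H a b) = (\<Sum>l\<in>UNIV. pairing (R i l) a * pairing (R l j) b)) \<and>
     (\<forall>i j. pairing (R i j) (hunit H) = (if i = j then 1 else 0))"

lemma rep_mult:
  "rep H R \<Longrightarrow> pairing (R i j) (hmult H a b) = (\<Sum>l\<in>UNIV. pairing (R i l) a * pairing (R l j) b)"
  and rep_unit: "rep H R \<Longrightarrow> pairing (R i j) (hunit H) = (if i = j then 1 else 0)"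
  by (simp_all add: rep_def)

text \<open>Only the algebra structure is meaningful.\<close>

definition matrix_algebra :: "('k::field, 'n::finite \<times> 'n) hopf" where
  "matrix_algebra =
     \<lparr>hmult = (\<lambda>a b. \<chi> p. \<Sum>l\<in>UNIV. a $ (fst p, l) * b $ (l, snd p)),
      hunit = (\<chi> p. if fst p = snd p then 1 else 0),
      comult = undefined, counit = undefined, antipode = undefined\<rparr>"

lemma matrix_algebra_mult_nth:
  "hmult matrix_algebra a b $ (i, j) = (\<Sum>l\<in>UNIV. a $ (i, l) * b $ (l, j))"
  by (simp add: matrix_algebra_def)

lemma matrix_algebra_unit_nth: "hunit matrix_algebra $ (i, j) = (if i = j then 1 else 0)"
  by (simp add: matrix_algebra_def)

interpretation matrix_algebra: unital_algebra "matrix_algebra :: ('k::field, 'n::finite \<times> 'n) hopf"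
proof (rule unital_algebra.intro)
  fix a b c :: "'k ^ ('n \<times> 'n)"
  show "lin (hmult matrix_algebra a)" "lin (\<lambda>a. hmult matrix_algebra a b)"
    by (auto intro!: linI simp: vec_eq_iff matrix_algebra_mult_nth algebra_simps sum.distrib
        sum_distrib_left)
  show "hmult matrix_algebra (hunit matrix_algebra) a = a"
    "hmult matrix_algebra a (hunit matrix_algebra) = a"
    by (auto simp: vec_eq_iff matrix_algebra_mult_nth matrix_algebra_unit_nth
        if_distrib if_distribR cong: if_cong)
  show "hmult matrix_algebra (hmult matrix_algebra a b) c
      = hmult matrix_algebra a (hmult matrix_algebra b c)"
  proof -
    have "(\<Sum>l\<in>UNIV. (\<Sum>m\<in>UNIV. a $ (i, m) * b $ (m, l)) * c $ (l, j))
        = (\<Sum>l\<in>UNIV. a $ (i, l) * (\<Sum>m\<in>UNIV. b $ (l, m) * c $ (m, j)))" for i j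
      unfolding sum_distrib_left sum_distrib_right mult.assoc by (rule sum.swap)
    then show ?thesis by (auto simp: vec_eq_iff matrix_algebra_mult_nth)
  qed
qed

text \<open>Evaluation at \<open>T\<close> kills the ideal generated by the relations, which is the
  whole kernel of evaluation at \<open>v\<close>, so it factors through \<open>H\<close>.\<close>

lemma (in unital_algebra) rep_exists:
  fixes T :: "'g \<Rightarrow> 'k ^ ('n::finite \<times> 'n)"
  assumes "presented_by H v X" "\<And>r. r \<in> X \<Longrightarrow> eval_free matrix_algebra T r = 0"
  obtains R where "rep H R" "\<And>g i j. pairing (R i j) (v g) = T g $ (i, j)"
proof -
  let ?e = "eval_free H v" and ?m = "eval_free (matrix_algebra :: ('k, 'n \<times> 'n) hopf) T"
  have surj: "surj ?e" and ker: "{p. ?e p = 0} = two_sided_ideal hull X"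
    using assms(1) by (simp_all add: presented_by_def)
  have "two_sided_ideal hull X \<subseteq> {p. ?m p = 0}"
    by (rule hull_minimal) (use assms(2) matrix_algebra.eval_free_kernel_ideal in auto)
  then have ker_le: "?e p = 0 \<Longrightarrow> ?m p = 0" for p
    using ker by auto
  \<comment> \<open>Any preimage will do: two of them differ by an element of the kernel, on which
    evaluation at \<open>T\<close> vanishes.\<close>
  define \<Phi> where "\<Phi> h = ?m (SOME q. ?e q = h)" for h
  have \<Phi>: "\<Phi> (?e q) = ?m q" for q
  proof -
    have "?e (SOME q'. ?e q' = ?e q) = ?e q" by (rule someI[of _ q]) simp
    then have "?e ((SOME q'. ?e q' = ?e q) - q) = 0" by (simp add: eval_free_simps)
    from ker_le[OF this] show ?thesis
      by (simp add: \<Phi>_def matrix_algebra.eval_free_diff)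
  qed
  have rep_of: "\<exists>q. h = ?e q" for h using surj by (metis surjD)
  have add: "\<Phi> (a + b) = \<Phi> a + \<Phi> b" for a b
  proof -
    obtain p q where "a = ?e p" "b = ?e q" using rep_of by meson
    then show ?thesis by (simp add: \<Phi> eval_free_add[symmetric] matrix_algebra.eval_free_add)
  qed
  have scale: "\<Phi> (k *s a) = k *s \<Phi> a" for k a
  proof -
    obtain q where q: "a = ?e q" using rep_of by blast
    have "k *s a = ?e (Poly_Mapping.single 0 k * q)" by (simp add: q eval_free_simps)
    then show ?thesis by (simp add: q \<Phi> matrix_algebra.eval_free_simps)
  qed
  have mult: "\<Phi> (hmult H a b) = hmult matrix_algebra (\<Phi> a) (\<Phi> b)" for a b
  proof -
    obtain p q where "a = ?e p" "b = ?e q" using rep_of by meson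
    then show ?thesis by (simp add: \<Phi> eval_free_mult[symmetric] matrix_algebra.eval_free_mult)
  qed
  have unit: "\<Phi> (hunit H) = hunit matrix_algebra"
    using \<Phi>[of 1] by (simp add: eval_free_one matrix_algebra.eval_free_one)
  have gen: "\<Phi> (v g) = T g" for g
    using \<Phi>[of "gen g"] by (simp add: eval_free_gen matrix_algebra.eval_free_gen)
  define R where "R i j = covector (\<lambda>h. \<Phi> h $ (i, j))" for i j
  have R: "pairing (R i j) h = \<Phi> h $ (i, j)" for i j h
    unfolding R_def by (rule pairing_covector)
      (simp add: Vector_Spaces.linear_iff vec.vector_space_axioms
        vector_space_over_itself.vector_space_axioms add scale)
  show thesis
    by (rule that[of R])
      (simp_all add: rep_def R mult unit gen matrix_algebra_mult_nth matrix_algebra_unit_nth)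
qed

text \<open>Words in the generators span \<open>H\<close>, and on a word both representations are
  products of the same matrices.\<close>

lemma (in unital_algebra) rep_unique:
  assumes surj: "surj (eval_free H v)" and R: "rep H R" and R': "rep H R'"
    and gen: "\<And>g i j. pairing (R i j) (v g) = pairing (R' i j) (v g)"
  shows "R = R'"
proof (intro ext)
  fix i j
  have w: "pairing (R i j) (foldr (\<lambda>x. hmult H (v x)) xs (hunit H))
      = pairing (R' i j) (foldr (\<lambda>x. hmult H (v x)) xs (hunit H))" for xs i j
    by (induction xs arbitrary: i j)
      (simp_all add: rep_unit[OF R] rep_unit[OF R'] rep_mult[OF R] rep_mult[OF R'] gen)
  have "pairing (R i j) a = pairing (R' i j) a" for a
  proof -
    obtain p where "a = eval_free H v p" using surj by (metis surjD)
    then show ?thesis by (simp add: eval_free_def pairing_sum w)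
  qed
  then show "R i j = R' i j"
    by (metis pairing_axis(2) vec_eq_iff)
qed

lemma (in hopf_algebra) pairing_tensor_mult:
  assumes f: "\<And>a b. pairing f (hmult H a b) = (\<Sum>l\<in>L. pairing (f1 l) a * pairing (f2 l) b)"
    and g: "\<And>a b. pairing g (hmult H a b) = (\<Sum>m\<in>M. pairing (g1 m) a * pairing (g2 m) b)"
  shows "pairing (tensor f g) (tensor_mult H s t) =
    (\<Sum>l\<in>L. \<Sum>m\<in>M. pairing (tensor (f1 l) (g1 m)) s * pairing (tensor (f2 l) (g2 m)) t)"
proof (induction s rule: tensor_induct)
  case (tensor a b)
  show ?case
  proof (induction t rule: tensor_induct)
    case (tensor c d)
    show ?case by (simp add: tensor_mult_tensor pairing_tensor f g sum_product mult_ac)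
  qed (simp_all add: algebra_simps sum.distrib sum_distrib_left)
qed (simp_all add: algebra_simps sum.distrib sum_distrib_left)

text \<open>The matrix coefficients of a tensor product of representations are convolution products
  of coefficients, and convolution is the product of the dual algebra.\<close>

definition tensor_rep :: "('k::field, 'i::finite) hopf \<Rightarrow> ('n \<Rightarrow> 'n \<Rightarrow> 'k ^ 'i) \<Rightarrow> ('m \<Rightarrow> 'm \<Rightarrow> 'k ^ 'i)
    \<Rightarrow> 'n \<times> 'm \<Rightarrow> 'n \<times> 'm \<Rightarrow> 'k ^ 'i" where
  "tensor_rep H R R' p q = hmult (dual_hopf H) (R (fst p) (fst q)) (R' (snd p) (snd q))"

lemma (in hopf_algebra) pairing_tensor_rep:
  "pairing (tensor_rep H R R' p q) a
    = pairing (tensor (R (fst p) (fst q)) (R' (snd p) (snd q))) (comult H a)"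
  by (simp add: tensor_rep_def pairing_dual_mult)

lemma (in hopf_algebra) rep_tensor_rep:
  assumes "rep H R" "rep H R'"
  shows "rep H (tensor_rep H R R')"
  unfolding rep_def
  by (simp add: pairing_tensor_rep comult_mult comult_unit pairing_tensor rep_unit[OF assms(1)]
      rep_unit[OF assms(2)] pairing_tensor_mult[OF rep_mult[OF assms(1)] rep_mult[OF assms(2)]]
      prod_eq_iff UNIV_Times_UNIV[symmetric] sum.cartesian_product' del: UNIV_Times_UNIV)

text \<open>Characters are handled as one-by-one representations indexed by \<open>unit\<close>, so
  that uniqueness of representations applies to them.\<close>

lemma (in hopf_algebra) rep_counit: "rep H (\<lambda>(_::unit) _. covector (counit H))"
  by (simp add: rep_def counit_mult counit_unit UNIV_unit)

section \<open>The Hopf algebra of dimension eight\<close>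

lemma tensor_diff: "tensor (a - b) c = tensor a c - tensor b c"
  by (simp add: vec_eq_iff tensor_def algebra_simps)

locale h8 = hopf_algebra H
  for H :: "('k::{alg_closed_field, field_char_0}, 'i::finite) hopf" +
  fixes v :: "h8_gen \<Rightarrow> 'k ^ 'i"
  assumes presented: "presented_by H v h8_relations"
    and comult_x: "comult H (v Gx) = tensor (v Gx) (v Gx)"
    and comult_y: "comult H (v Gy) = tensor (v Gy) (v Gy)"
    and comult_z: "comult H (v Gz) = (1 / 2) *s tensor_mult H
      (tensor (hunit H + v Gy) (hunit H) + tensor (hunit H - v Gy) (v Gx)) (tensor (v Gz) (v Gz))"
    and counit_x: "counit H (v Gx) = 1" and counit_y: "counit H (v Gy) = 1"
    and counit_z: "counit H (v Gz) = 1"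
begin

abbreviation prd (infixl "\<odot>" 70) where "a \<odot> b \<equiv> hmult H a b"
abbreviation "e \<equiv> hunit H"
abbreviation "x \<equiv> v Gx"
abbreviation "y \<equiv> v Gy"
abbreviation "z \<equiv> v Gz"

lemma eval_relations: "\<forall>r\<in>h8_relations. eval_free H v r = 0"
  using presented hull_subset[of h8_relations two_sided_ideal] by (auto simp: presented_by_def)

lemma relations:
  "x \<odot> x = e" "y \<odot> y = e" "y \<odot> x = x \<odot> y" "z \<odot> x = y \<odot> z" "z \<odot> y = x \<odot> z"
  "z \<odot> z = (1 / 2) *s (e + x + y - x \<odot> y)"
  using eval_relations by (simp_all add: h8_relations_def eval_free_simps)

lemma relations_assoc:
  "x \<odot> (x \<odot> a) = a" "y \<odot> (y \<odot> a) = a" "y \<odot> (x \<odot> a) = x \<odot> (y \<odot> a)" "z \<odot> (x \<odot> a) = y \<odot> (z \<odot> a)"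
  "z \<odot> (y \<odot> a) = x \<odot> (z \<odot> a)" "z \<odot> (z \<odot> a) = (1 / 2) *s (a + x \<odot> a + y \<odot> a - x \<odot> (y \<odot> a))"
  by (simp_all add: hmult_assoc[symmetric] relations)

lemmas h8_simps = hmult_assoc relations relations_assoc

definition basis :: "('k ^ 'i) set" where
  "basis = {e, x, y, x \<odot> y, z, x \<odot> z, y \<odot> z, x \<odot> (y \<odot> z)}"

lemma basis_in_span:
  "e \<in> vec.span basis" "x \<in> vec.span basis" "y \<in> vec.span basis" "x \<odot> y \<in> vec.span basis"
  "z \<in> vec.span basis" "x \<odot> z \<in> vec.span basis" "y \<odot> z \<in> vec.span basis"
  "x \<odot> (y \<odot> z) \<in> vec.span basis"
  by (simp_all add: basis_def vec.span_base)

text \<open>The relations carry \<open>x\<close> and \<open>y\<close> to the left past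
  \<open>z\<close>, exchanging them, and rewrite the square of \<open>z\<close> in terms of
  \<open>x\<close> and \<open>y\<close>. Left multiplication by a generator therefore preserves the
  span.\<close>

lemma span_basis: "a \<in> vec.span basis"
proof -
  have gen: "v g \<odot> b \<in> vec.span basis" if "b \<in> vec.span basis" for g b
    using that
  proof (induction rule: vec.span_induct_alt)
    case base
    show ?case by (simp add: vec.span_zero)
  next
    case (step c b b')
    have "v g \<odot> b \<in> vec.span basis"
      using step(1) by (cases g) (auto simp: basis_def[THEN eqset_imp_iff] h8_simps basis_in_span
          intro!: vec.span_scale vec.span_add vec.span_diff)
    then show ?case using step by (simp add: vec.span_scale vec.span_add)
  qed
  obtain p where p: "a = eval_free H v p"
    using presented by (metis presented_by_def surjD)
  have "foldr (\<lambda>x. hmult H (v x)) ws e \<in> vec.span basis" for ws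
    by (induction ws) (simp_all add: gen basis_in_span)
  then show ?thesis
    by (simp add: p eval_free_def vec.span_sum vec.span_scale)
qed

lemma basis_expansion_h8:
  obtains c1 c2 c3 c4 d1 d2 d3 d4 where
    "a = c1 *s e + c2 *s x + c3 *s y + c4 *s (x \<odot> y)
       + d1 *s z + d2 *s (x \<odot> z) + d3 *s (y \<odot> z) + d4 *s (x \<odot> (y \<odot> z))"
proof -
  have "\<exists>c1 c2 c3 c4 d1 d2 d3 d4. a - c1 *s e - c2 *s x - c3 *s y - c4 *s (x \<odot> y)
       - d1 *s z - d2 *s (x \<odot> z) - d3 *s (y \<odot> z) - d4 *s (x \<odot> (y \<odot> z)) = 0"
    using span_basis[of a] unfolding basis_def vec.span_breakdown_eq vec.span_empty
    by (simp only: singleton_iff)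
  then show thesis by (smt (verit, del_insts) that diff_diff_eq eq_iff_diff_eq_0 add.assoc)
qed

section \<open>The coproduct of \<open>z\<close> and the antipode\<close>

lemma comult_z_expand:
  "comult H z = (1 / 2) *s (tensor z z + tensor (y \<odot> z) z + tensor z (x \<odot> z)
    - tensor (y \<odot> z) (x \<odot> z))"
  by (simp add: comult_z tensor_mult_tensor tensor_diff tensor_mult_diff algebra_simps)

text \<open>The left antipode axiom at \<open>t \<odot> z\<close>, for \<open>t = u\<close> and
  \<open>t = u \<odot> y\<close>, involves only the antipodes of \<open>u \<odot> z\<close> and
  \<open>u \<odot> (y \<odot> z)\<close>. Eliminating the second determines the first.\<close>

lemma antipode_mult_z:
  assumes u: "comult H u = tensor u u" "counit H u = 1" "u \<odot> u = e"
    and comm: "u \<odot> x = x \<odot> u" "u \<odot> y = y \<odot> u"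
  shows "antipode H (u \<odot> z) = z \<odot> u"
proof -
  let ?m = "\<lambda>b c. antipode H b \<odot> c" and ?w = "z \<odot> (z \<odot> z)"
  have bil: "bilin ?m"
    by (rule bilinI) simp_all
  note tl = tlift_tensor[OF bil] and tl_diff = lin_diff[OF tlift_lin, of ?m]
  have z4: "z \<odot> (z \<odot> (z \<odot> (z \<odot> a))) = a" for a
    by (simp add: h8_simps vec_eq_iff field_simps)
  \<comment> \<open>The fourth power of \<open>z\<close> is 1, so its inverse is \<open>?w\<close>,
    and the trailing \<open>z\<close> common to all terms of the axiom can be cancelled.\<close>
  have key: "?m (t \<odot> z) t + ?m (t \<odot> (y \<odot> z)) t + ?m (t \<odot> z) (t \<odot> x) - ?m (t \<odot> (y \<odot> z)) (t \<odot> x)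
      = 2 *s ?w" (is "?K = _")
    if t: "comult H t = tensor t t" "counit H t = 1" for t
  proof -
    have "comult H (t \<odot> z) = (1 / 2) *s (tensor (t \<odot> z) (t \<odot> z) + tensor (t \<odot> (y \<odot> z)) (t \<odot> z)
        + tensor (t \<odot> z) (t \<odot> (x \<odot> z)) - tensor (t \<odot> (y \<odot> z)) (t \<odot> (x \<odot> z)))"
      by (simp add: comult_mult t comult_z_expand tensor_mult_tensor tensor_mult_diff)
    then have "(1 / 2) *s ?K \<odot> z = e"
      using antipode_left[of "t \<odot> z"] by (simp add: tl tl_diff counit_mult t counit_z hmult_assoc)
    then have "(1 / 2) *s ?K \<odot> (z \<odot> ?w) = ?w"
      by (metis hmult_assoc hunit_left)
    moreover have "z \<odot> ?w = e" using z4[of e] by simp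
    ultimately have "(1 / 2) *s ?K = ?w" by simp
    then have "2 *s ((1 / 2) *s ?K) = 2 *s ?w" by (rule arg_cong)
    then show ?thesis by simp
  qed
  define a where "a = antipode H (u \<odot> z) \<odot> u"
  define b where "b = antipode H (u \<odot> (y \<odot> z)) \<odot> u"
  have k1: "a + b + a \<odot> x - b \<odot> x = 2 *s ?w"
    using key[OF u(1,2)] by (simp add: a_def b_def hmult_assoc)
  have "comult H (u \<odot> y) = tensor (u \<odot> y) (u \<odot> y)" "counit H (u \<odot> y) = 1"
    by (simp_all add: comult_mult u comult_y tensor_mult_tensor counit_mult counit_y)
  from key[OF this] have k2: "b \<odot> y + a \<odot> y + b \<odot> (x \<odot> y) - a \<odot> (x \<odot> y) = 2 *s ?w"
    by (simp add: a_def b_def hmult_assoc relations relations_assoc)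
  have two: "p = q" if "2 *s p = 2 *s q" for p q :: "'k ^ 'i"
    using that by (metis vector_mul_lcancel zero_neq_numeral)
  \<comment> \<open>Right multiplication by \<open>e + x\<close> cancels the terms in
    \<open>b\<close>, because \<open>x \<odot> x = e\<close>.\<close>
  have "2 *s (a + a \<odot> x) = (a + b + a \<odot> x - b \<odot> x) + (a + b + a \<odot> x - b \<odot> x) \<odot> x"
    by (simp add: hmult_assoc relations vec_eq_iff)
  also have "\<dots> = 2 *s (?w + ?w \<odot> x)"
    unfolding k1 by (simp only: mult_simps vec.scale_right_distrib)
  finally have h1: "a + a \<odot> x = ?w + ?w \<odot> x" by (rule two)
  let ?s = "b \<odot> y + a \<odot> y + b \<odot> (x \<odot> y) - a \<odot> (x \<odot> y)"
  \<comment> \<open>Here right multiplication by \<open>y - x \<odot> y\<close> cancels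
    \<open>b\<close>.\<close>
  have "2 *s (a - a \<odot> x) = ?s \<odot> y - ?s \<odot> (x \<odot> y)"
    by (simp add: hmult_assoc relations relations_assoc vec_eq_iff)
  also have "\<dots> = 2 *s (?w \<odot> y - ?w \<odot> (x \<odot> y))"
    unfolding k2 by (simp only: mult_simps vec.scale_right_diff_distrib)
  finally have h2: "a - a \<odot> x = ?w \<odot> y - ?w \<odot> (x \<odot> y)" by (rule two)
  have "a = (1 / 2) *s ((a + a \<odot> x) + (a - a \<odot> x))"
    by (simp add: vec_eq_iff)
  \<comment> \<open>The four terms reassemble the square of \<open>z\<close>, so \<open>a\<close> is
    the fifth power of \<open>z\<close>, which is \<open>z\<close>.\<close>
  also have "\<dots> = ?w \<odot> (z \<odot> z)"
    unfolding h1 h2 relations(6) by (simp only: mult_simps hunit_right add_diff_eq add.assoc)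
  also have "\<dots> = z"
    using z4 by (simp only: hmult_assoc)
  finally have "a \<odot> u = z \<odot> u" by simp
  then show ?thesis by (simp add: a_def hmult_assoc u(3))
qed

lemma antipode_grouplike:
  assumes u: "comult H u = tensor u u" "counit H u = 1" "u \<odot> u = e"
  shows "antipode H u = u"
proof -
  have "bilin (\<lambda>b c. antipode H b \<odot> c)"
    by (rule bilinI) simp_all
  from tlift_tensor[OF this] have "antipode H u \<odot> u = e"
    using antipode_left[of u] by (simp add: u)
  then have "antipode H u \<odot> u \<odot> u = u" by simp
  then show ?thesis by (simp add: hmult_assoc u(3))
qed

lemma comult_xy: "comult H (x \<odot> y) = tensor (x \<odot> y) (x \<odot> y)"
  by (simp add: comult_mult comult_x comult_y tensor_mult_tensor)

text \<open>The product of the double uses \<open>inv_into\<close> of the antipode, a true inverse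
  only for a bijection. The antipode permutes the words in \<open>basis\<close>, so it is onto,
  hence injective in finite dimension.\<close>

lemma bij_antipode: "bij (antipode H)"
proof -
  have "antipode H e = e" "antipode H x = x" "antipode H y = y" "antipode H (x \<odot> y) = x \<odot> y"
    by (rule antipode_grouplike; simp add: comult_unit comult_x comult_y comult_xy counit_unit
        counit_x counit_y counit_mult h8_simps)+
  moreover have "antipode H (e \<odot> z) = z \<odot> e" "antipode H (x \<odot> z) = z \<odot> x"
    "antipode H (y \<odot> z) = z \<odot> y" "antipode H ((x \<odot> y) \<odot> z) = z \<odot> (x \<odot> y)"
    by (rule antipode_mult_z; simp add: comult_unit comult_x comult_y comult_xy counit_unit
        counit_x counit_y counit_mult h8_simps)+
  ultimately have "basis \<subseteq> range (antipode H)"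
    unfolding basis_def by (simp add: h8_simps) (metis rangeI)
  then have "vec.span basis \<subseteq> range (antipode H)"
    by (rule vec.span_minimal) (rule vec.linear_subspace_image[OF linear_antipode vec.subspace_UNIV])
  then have "surj (antipode H)"
    using span_basis by auto
  then show ?thesis
    using vec.linear_surj_imp_inj[OF linear_antipode] by (simp add: bij_def)
qed

end

lemma UNIV_quat_unit: "UNIV = {Q1, Qi, Qj, Qk}"
  using quat_unit.exhaust by auto

lemma sum_q8: "(\<Sum>g\<in>(UNIV :: q8 set). f g) =
    f (False, Q1) + f (False, Qi) + f (False, Qj) + f (False, Qk)
  + f (True, Q1) + f (True, Qi) + f (True, Qj) + f (True, Qk)"
  by (simp add: UNIV_Times_UNIV[symmetric] sum.cartesian_product'[symmetric] UNIV_bool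
      UNIV_quat_unit add.assoc del: UNIV_Times_UNIV)

section \<open>Characters and the two-dimensional representation\<close>

context h8
begin

lemma rep_ext:
  assumes "rep H R" "rep H R'"
    and "\<And>i j. pairing (R i j) x = pairing (R' i j) x"
    and "\<And>i j. pairing (R i j) y = pairing (R' i j) y"
    and "\<And>i j. pairing (R i j) z = pairing (R' i j) z"
  shows "R = R'"
proof (rule rep_unique[OF _ assms(1,2)])
  show "surj (eval_free H v)" using presented by (simp add: presented_by_def)
  show "pairing (R i j) (v g) = pairing (R' i j) (v g)" for g i j
    by (cases g) (simp_all add: assms)
qed

text \<open>If \<open>x\<close> and \<open>y\<close> both go to \<open>\<xi>\<close> with square 1,
  then \<open>1 + x + y - x y\<close> goes to \<open>2 * \<xi>\<close>, and the relation for the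
  square of \<open>z\<close> becomes \<open>\<zeta> * \<zeta> = \<xi>\<close>. Its solutions give
  four characters.\<close>

lemma character_exists:
  assumes "\<xi> * \<xi> = 1" "\<zeta> * \<zeta> = \<xi>"
  obtains f where "rep H (\<lambda>(_::unit) _. f)" "pairing f x = \<xi>" "pairing f y = \<xi>" "pairing f z = \<zeta>"
proof -
  define T :: "h8_gen \<Rightarrow> 'k ^ (unit \<times> unit)" where
    "T g = (\<chi> p. case g of Gz \<Rightarrow> \<zeta> | _ \<Rightarrow> \<xi>)" for g
  have rel: "eval_free matrix_algebra T r = 0" if "r \<in> h8_relations" for r
    using that by (auto simp: h8_relations_def matrix_algebra.eval_free_simps vec_eq_iff
        matrix_algebra_mult_nth matrix_algebra_unit_nth UNIV_unit T_def assms)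
  obtain R where "rep H R" "\<And>g i j. pairing (R i j) (v g) = T g $ (i, j)"
    using rep_exists[OF presented, of T] rel by metis
  then show thesis by (intro that[of "R () ()"]) (simp_all add: T_def)
qed

text \<open>The two basis vectors are eigenvectors of \<open>x\<close> and \<open>y\<close> with
  opposite signs, and \<open>z\<close> exchanges them. Since \<open>x + y\<close> goes to 0 and
  \<open>x \<odot> y\<close> to minus the identity, both sides of the last relation are the
  identity.\<close>

lemma standard_rep_exists:
  obtains \<sigma> where "rep H \<sigma>"
    "\<And>i j. pairing (\<sigma> i j) x = (if i = j then if i then 1 else -1 else 0)"
    "\<And>i j. pairing (\<sigma> i j) y = (if i = j then if i then -1 else 1 else 0)"
    "\<And>i j. pairing (\<sigma> i j) z = (if i = j then 0 else 1)"
proof -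
  define T :: "h8_gen \<Rightarrow> 'k ^ (bool \<times> bool)" where
    "T g = (\<chi> p. case g of
        Gx \<Rightarrow> if fst p = snd p then if fst p then 1 else -1 else 0
      | Gy \<Rightarrow> if fst p = snd p then if fst p then -1 else 1 else 0
      | Gz \<Rightarrow> if fst p = snd p then 0 else 1)" for g
  have rel: "eval_free matrix_algebra T r = 0" if "r \<in> h8_relations" for r
    using that by (auto simp: h8_relations_def matrix_algebra.eval_free_simps vec_eq_iff
        matrix_algebra_mult_nth matrix_algebra_unit_nth UNIV_bool T_def)
  obtain R where "rep H R" "\<And>g i j. pairing (R i j) (v g) = T g $ (i, j)"
    using rep_exists[OF presented, of T] rel by metis
  then show thesis by (intro that[of R]) (simp_all add: T_def)
qed

lemma character_mult: "rep H (\<lambda>(_::unit) _. f) \<Longrightarrow> pairing f (a \<odot> b) = pairing f a * pairing f b"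
  and character_unit: "rep H (\<lambda>(_::unit) _. f) \<Longrightarrow> pairing f e = 1"
  by (simp_all add: rep_def UNIV_unit)

text \<open>On \<open>z\<close> the twisting factor of the coproduct contributes
  \<open>\<xi>\<close> and the square of \<open>pairing f z\<close> contributes another
  \<open>\<xi>\<close>, with product 1.\<close>

lemma character_square:
  assumes f: "rep H (\<lambda>(_::unit) _. f)"
    and \<xi>: "pairing f x = \<xi>" "pairing f y = \<xi>" "\<xi> * \<xi> = 1"
    and \<zeta>: "pairing f z * pairing f z = \<xi>"
  shows "hmult (dual_hopf H) f f = covector (counit H)"
proof -
  let ?R = "\<lambda>(_::unit) (_::unit). f"
  have "rep H (\<lambda>(_::unit \<times> unit) _. covector (counit H))"
    by (simp add: rep_def counit_mult counit_unit UNIV_unit UNIV_Times_UNIV[symmetric]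
        del: UNIV_Times_UNIV)
  with rep_tensor_rep[OF f f] have "tensor_rep H ?R ?R = (\<lambda>_ _. covector (counit H))"
  proof (rule rep_ext)
    fix i j :: "unit \<times> unit"
    show "pairing (tensor_rep H ?R ?R i j) x = pairing (covector (counit H)) x"
      "pairing (tensor_rep H ?R ?R i j) y = pairing (covector (counit H)) y"
      by (simp_all add: pairing_tensor_rep comult_x comult_y pairing_tensor \<xi> counit_x counit_y)
    have "pairing (tensor f f) (comult H z)
        = (1 / 2) * (pairing f z * pairing f z) * (1 + \<xi> + \<xi> - \<xi> * \<xi>)"
      by (simp add: comult_z_expand pairing_tensor character_mult[OF f] \<xi>(1,2) field_simps)
    also have "\<dots> = 1"
      using \<xi>(3) by (simp add: \<zeta>)
    finally show "pairing (tensor_rep H ?R ?R i j) z = pairing (covector (counit H)) z"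
      by (simp add: pairing_tensor_rep counit_z)
  qed
  from fun_cong[OF fun_cong[OF this]] show ?thesis
    by (simp add: tensor_rep_def)
qed

text \<open>The right-hand side is the direct sum of the counit, \<open>c\<close>, \<open>a\<close>
  and \<open>b\<close> in another basis: \<open>x\<close> and \<open>y\<close> act by 1 on tensors
  with equal indices and by -1 on the others. Once it is known to be a representation, comparison at
  the generators suffices.\<close>

lemma standard_rep_square:
  assumes \<sigma>: "rep H \<sigma>"
    "\<And>i j. pairing (\<sigma> i j) x = (if i = j then if i then 1 else -1 else 0)"
    "\<And>i j. pairing (\<sigma> i j) y = (if i = j then if i then -1 else 1 else 0)"
    "\<And>i j. pairing (\<sigma> i j) z = (if i = j then 0 else 1)"
    and \<iota>: "\<iota> * \<iota> = -1"
    and c: "rep H (\<lambda>(_::unit) _. c)" "pairing c x = 1" "pairing c y = 1" "pairing c z = -1"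
    and a: "rep H (\<lambda>(_::unit) _. a)" "pairing a x = -1" "pairing a y = -1" "pairing a z = \<iota>"
    and b: "rep H (\<lambda>(_::unit) _. b)" "pairing b x = -1" "pairing b y = -1" "pairing b z = -\<iota>"
  shows "tensor_rep H \<sigma> \<sigma> = (\<lambda>(i, j) (k, l).
      if i = j \<and> k = l then (1 / 2) *s (covector (counit H) + (if i = k then 1 else -1) *s c)
      else if i \<noteq> j \<and> k \<noteq> l then
        if i = k then (1 / 2) *s (a + b) else ((if i then \<iota> else -\<iota>) / 2) *s (a - b)
      else 0)" (is "_ = ?M")
proof -
  note mult = character_mult[OF a(1)] character_mult[OF b(1)] character_mult[OF c(1)] counit_mult
  note unit = character_unit[OF a(1)] character_unit[OF b(1)] character_unit[OF c(1)] counit_unit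
  have \<iota>': "\<iota> * (\<iota> * t) = - t" for t
    by (simp add: \<iota> mult.assoc[symmetric])
  have M: "rep H ?M"
    unfolding rep_def
  proof (intro conjI allI)
    fix p q h h'
    show "pairing (?M p q) (h \<odot> h') = (\<Sum>l\<in>UNIV. pairing (?M p l) h * pairing (?M l q) h')"
      by (cases p; cases q; cases "fst p"; cases "snd p"; cases "fst q"; cases "snd q")
        (simp_all add: UNIV_bool UNIV_Times_UNIV[symmetric] sum.cartesian_product'[symmetric] mult
          algebra_simps \<iota> \<iota>' del: UNIV_Times_UNIV)
    show "pairing (?M p q) e = (if p = q then 1 else 0)"
      by (cases p; cases q) (auto simp: unit)
  qed
  have sum2: "(\<Sum>i\<in>UNIV. f i) = f True + f False" for f :: "bool \<Rightarrow> 'k"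
    by (simp add: UNIV_bool)
  show ?thesis
  proof (rule rep_ext[OF rep_tensor_rep[OF \<sigma>(1) \<sigma>(1)] M])
    fix p q
    show "pairing (tensor_rep H \<sigma> \<sigma> p q) x = pairing (?M p q) x"
      "pairing (tensor_rep H \<sigma> \<sigma> p q) y = pairing (?M p q) y"
      by (cases p; cases q; simp add: pairing_tensor_rep comult_x comult_y pairing_tensor \<sigma> a b c
          counit_x counit_y; fail)+
    show "pairing (tensor_rep H \<sigma> \<sigma> p q) z = pairing (?M p q) z"
      by (cases p; cases q) (auto simp: pairing_tensor_rep comult_z_expand pairing_tensor
          rep_mult[OF \<sigma>(1)] sum2 \<sigma> a b c counit_z \<iota> field_simps)
  qed
qed

end

lemma sum_swap4:
  "(\<Sum>i\<in>A. \<Sum>j\<in>B. \<Sum>k\<in>C. \<Sum>l\<in>D. f i j k l) = (\<Sum>k\<in>C. \<Sum>l\<in>D. \<Sum>i\<in>A. \<Sum>j\<in>B. f i j k l)"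
proof -
  have "(\<Sum>i\<in>A. \<Sum>j\<in>B. \<Sum>k\<in>C. \<Sum>l\<in>D. f i j k l) = (\<Sum>i\<in>A. \<Sum>k\<in>C. \<Sum>j\<in>B. \<Sum>l\<in>D. f i j k l)"
    by (rule sum.cong[OF refl], rule sum.swap)
  also have "\<dots> = (\<Sum>k\<in>C. \<Sum>i\<in>A. \<Sum>j\<in>B. \<Sum>l\<in>D. f i j k l)"
    by (rule sum.swap)
  also have "\<dots> = (\<Sum>k\<in>C. \<Sum>i\<in>A. \<Sum>l\<in>D. \<Sum>j\<in>B. f i j k l)"
    by (rule sum.cong[OF refl], rule sum.cong[OF refl], rule sum.swap)
  also have "\<dots> = (\<Sum>k\<in>C. \<Sum>l\<in>D. \<Sum>i\<in>A. \<Sum>j\<in>B. f i j k l)"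
    by (rule sum.cong[OF refl], rule sum.swap)
  finally show ?thesis .
qed

section \<open>Quaternionic gradings of the coalgebra\<close>

text \<open>
  A Hopf algebra map from the co-opposite dual to the group algebra of the quaternion group sends
  \<open>f\<close> to the sum of all \<open>f (r g) \<cdot> g\<close>, for orthogonal idempotents \<open>r g\<close> as follows.
\<close>

locale h8_q8 = h8 H v
  for H :: "('k::{alg_closed_field, field_char_0}, 'i::finite) hopf" and v +
  fixes r :: "q8 \<Rightarrow> 'k ^ 'i"
  assumes r_mult: "hmult H (r g) (r h) = (if g = h then r g else 0)"
    and r_sum: "(\<Sum>g\<in>UNIV. r g) = hunit H"
    and r_counit: "counit H (r (False, Q1)) = 1"
    and r_comult: "pairing (tensor f f') (comult H (r g)) =
      (\<Sum>a\<in>UNIV. \<Sum>b\<in>UNIV. if q8_mult a b = g then pairing f (r a) * pairing f' (r b) else 0)"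
begin

text \<open>The convolution square at \<open>r (False, Q1)\<close> expresses 1 as a sum over
  \<open>a b = 1\<close>. Orthogonality keeps only \<open>a = b\<close>, and only
  \<open>\<plusminus>1\<close> square to 1. The values at these two already sum to 1, so
  orthogonality kills all others.\<close>

lemma character_r_eq_0:
  assumes f: "rep H (\<lambda>(_::unit) _. f)" and f2: "hmult (dual_hopf H) f f = covector (counit H)"
    and m: "snd m \<noteq> Q1"
  shows "pairing f (r m) = 0"
proof -
  have r: "pairing f (r g) * pairing f (r h) = (if g = h then pairing f (r g) else 0)" for g h
    by (simp add: character_mult[OF f, symmetric] r_mult)
  have "1 = pairing (hmult (dual_hopf H) f f) (r (False, Q1))"
    by (simp add: f2 r_counit)
  also have "\<dots> = (\<Sum>a\<in>UNIV. \<Sum>b\<in>UNIV.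
      if b = a then if q8_mult a a = (False, Q1) then pairing f (r a) else 0 else 0)"
    unfolding pairing_dual_mult r_comult r by (intro sum.cong refl) simp
  also have "\<dots> = (\<Sum>a\<in>UNIV. if q8_mult a a = (False, Q1) then pairing f (r a) else 0)"
    by simp
  also have "\<dots> = pairing f (r (False, Q1)) + pairing f (r (True, Q1))"
    by (simp add: sum_q8 q8_mult_def)
  finally have "pairing f (r m) = pairing f (r m) * (pairing f (r (False, Q1)) + pairing f (r (True, Q1)))"
    by simp
  also have "\<dots> = 0"
    using m by (auto simp: distrib_left r)
  finally show ?thesis .
qed

lemma rep_r_mult:
  "rep H R \<Longrightarrow> (\<Sum>l\<in>UNIV. pairing (R i l) (r c) * pairing (R l j) (r d))
    = (if c = d then pairing (R i j) (r c) else 0)"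
  by (simp add: rep_mult[symmetric] r_mult)

text \<open>Multiplying the expansion of the tensor square at \<open>r (q8_mult c d)\<close> on the
  left by the tensor product of the matrices of \<open>r c\<close> and \<open>r d\<close> leaves, by
  orthogonality, the single term \<open>a = c\<close>, \<open>b = d\<close>.\<close>

lemma rep_r_orthogonal:
  assumes R: "rep H R" and "\<And>p q. pairing (tensor_rep H R R p q) (r (q8_mult c d)) = 0"
  shows "pairing (R i k) (r c) * pairing (R j l) (r d) = 0"
proof -
  let ?P = "\<lambda>c i j. pairing (R i j) (r c)" and ?cd = "q8_mult c d"
  have sum0: "(\<Sum>a\<in>UNIV. \<Sum>b\<in>UNIV. if q8_mult a b = ?cd then ?P a k' k * ?P b l' l else 0) = 0"
    for k' l'
    using assms(2)[of "(k', l')" "(k, l)"] by (simp add: pairing_tensor_rep r_comult)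
  have "0 = (\<Sum>k'\<in>UNIV. \<Sum>l'\<in>UNIV. ?P c i k' * ?P d j l' *
      (\<Sum>a\<in>UNIV. \<Sum>b\<in>UNIV. if q8_mult a b = ?cd then ?P a k' k * ?P b l' l else 0))"
    unfolding sum0 by simp
  also have "\<dots> = (\<Sum>k'\<in>UNIV. \<Sum>l'\<in>UNIV. \<Sum>a\<in>UNIV. \<Sum>b\<in>UNIV.
      if q8_mult a b = ?cd then (?P c i k' * ?P a k' k) * (?P d j l' * ?P b l' l) else 0)"
    unfolding sum_distrib_left by (intro sum.cong refl) simp
  also have "\<dots> = (\<Sum>a\<in>UNIV. \<Sum>b\<in>UNIV. \<Sum>k'\<in>UNIV. \<Sum>l'\<in>UNIV.
      if q8_mult a b = ?cd then (?P c i k' * ?P a k' k) * (?P d j l' * ?P b l' l) else 0)"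
    by (rule sum_swap4)
  also have "\<dots> = (\<Sum>a\<in>UNIV. \<Sum>b\<in>UNIV.
      if q8_mult a b = ?cd then (\<Sum>k'\<in>UNIV. ?P c i k' * ?P a k' k) * (\<Sum>l'\<in>UNIV. ?P d j l' * ?P b l' l)
      else 0)"
    by (intro sum.cong refl) (simp add: sum_product)
  also have "\<dots> = (\<Sum>a\<in>UNIV. \<Sum>b\<in>UNIV. if b = d then if a = c then ?P c i k * ?P d j l else 0 else 0)"
    unfolding rep_r_mult[OF R] by (intro sum.cong refl) simp
  also have "\<dots> = ?P c i k * ?P d j l"
    by simp
  finally show ?thesis by simp
qed

lemma standard_rep_r_eq_0:
  assumes \<sigma>: "rep H (\<sigma> :: bool \<Rightarrow> bool \<Rightarrow> 'k ^ 'i)"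
    and zero: "\<And>m p q. snd m \<noteq> Q1 \<Longrightarrow> pairing (tensor_rep H \<sigma> \<sigma> p q) (r m) = 0"
    and row1: "pairing (tensor_rep H \<sigma> \<sigma> (True, True) (True, True)) (r (False, Q1))
      + pairing (tensor_rep H \<sigma> \<sigma> (True, True) (False, False)) (r (False, Q1)) = 1"
    and row2: "pairing (tensor_rep H \<sigma> \<sigma> (False, False) (True, True)) (r (False, Q1))
      + pairing (tensor_rep H \<sigma> \<sigma> (False, False) (False, False)) (r (False, Q1)) = 1"
    and skew: "pairing (tensor_rep H \<sigma> \<sigma> (True, False) (False, True)) (r (False, Q1))
      = - pairing (tensor_rep H \<sigma> \<sigma> (False, True) (True, False)) (r (False, Q1))"
    and g: "snd g \<noteq> Q1"
  shows "pairing (\<sigma> i j) (r g) = 0"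
proof (rule ccontr)
  assume nz: "pairing (\<sigma> i j) (r g) \<noteq> 0"
  define P where "P c i j = pairing (\<sigma> i j) (r c)" for c i j
  define g' where "g' = (\<not> fst g, snd g)"
  \<comment> \<open>For \<open>c\<close> with another unit than \<open>g\<close>, the product
    \<open>q8_mult g c\<close> is not \<open>\<plusminus>1\<close>, so the nonzero coefficient at
    \<open>g\<close> forces those at \<open>c\<close> to vanish.\<close>
  have P0: "P c k l = 0" if "snd c \<noteq> snd g" for c k l
  proof -
    have "snd (q8_mult g c) \<noteq> Q1"
      using that g by (cases "snd g"; cases "snd c") (auto simp: q8_mult_def Let_def)
    from rep_r_orthogonal[OF \<sigma> zero[OF this], of i j k l] show ?thesis
      using nz by (simp add: P_def)
  qed
  have sumP: "P g' k l = (if k = l then 1 else 0) - P g k l" for k l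
  proof -
    have "(\<Sum>c\<in>UNIV. P c k l) = (if k = l then 1 else 0)"
      by (simp add: P_def pairing_sum[symmetric] r_sum rep_unit[OF \<sigma>])
    then have "P g k l + P g' k l = (if k = l then 1 else 0)"
      using g P0 by (cases g; cases "fst g"; cases "snd g") (auto simp: sum_q8 g'_def add.commute)
    then show ?thesis by (simp add: algebra_simps)
  qed
  \<comment> \<open>Of the products formed from \<open>g\<close> and \<open>g'\<close>, only the two
    mixed ones equal 1, since \<open>g\<close> squares to -1.\<close>
  have N: "pairing (tensor_rep H \<sigma> \<sigma> (k, m) (l, n)) (r (False, Q1)) =
      P g k l * P g' m n + P g' k l * P g m n" for k l m n
  proof -
    have "(\<Sum>a\<in>UNIV. \<Sum>b\<in>UNIV. if q8_mult a b = (False, Q1) then P a k l * P b m n else 0)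
        = P g k l * P g' m n + P g' k l * P g m n"
      using g P0 by (cases g; cases "fst g"; cases "snd g")
        (auto simp: sum_q8 g'_def q8_mult_def Let_def add.commute)
    then show ?thesis by (simp add: pairing_tensor_rep r_comult P_def[symmetric] cong: if_cong)
  qed
  let ?A = "P g True True" and ?B = "P g True False" and ?C = "P g False True"
    and ?D = "P g False False"
  have idem: "?A * ?A + ?B * ?C = ?A" "?B * ?C + ?D * ?D = ?D"
    using rep_r_mult[OF \<sigma>, of True g True g] rep_r_mult[OF \<sigma>, of False g False g]
    by (simp_all add: P_def UNIV_bool algebra_simps)
  \<comment> \<open>Both entries named in \<open>skew\<close> equal \<open>- 2 * (?B * ?C)\<close>;
    being opposite, they vanish.\<close>
  have "4 * (?B * ?C) = 0"
    using skew by (simp add: N sumP algebra_simps)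
  then have BC: "?B * ?C = 0" by simp
  note AD = idem[unfolded BC add_0_left add_0_right]
  \<comment> \<open>With \<open>BC\<close> in force, idempotence removes the diagonal terms; the
    rows then make \<open>?B\<close> and \<open>?C\<close> both nonzero, against
    \<open>BC\<close>.\<close>
  have "2 * (?A - ?A * ?A) - 2 * (?B * ?B) = 1" "2 * (?D - ?D * ?D) - 2 * (?C * ?C) = 1"
    using row1 row2 by (simp_all add: N sumP algebra_simps)
  then have "- (2 * (?B * ?B)) = 1" "- (2 * (?C * ?C)) = 1"
    unfolding AD by simp_all
  then have "2 * (?B * ?B) = -1" "2 * (?C * ?C) = -1"
    by (simp_all only: minus_equation_iff)
  then have "(2 * (?B * ?B)) * (2 * (?C * ?C)) = 1" by simp
  moreover have "(2 * (?B * ?B)) * (2 * (?C * ?C)) = 4 * (?B * ?C) * (?B * ?C)"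
    by (simp add: algebra_simps)
  ultimately show False by (simp add: BC)
qed

lemma r_eq_0:
  assumes g: "snd g \<noteq> Q1"
  shows "r g = 0"
proof -
  obtain \<iota> :: 'k where "\<iota> ^ 2 = -1"
    using nth_root_exists[of 2 "-1 :: 'k"] by auto
  then have \<iota>: "\<iota> * \<iota> = -1" by (simp add: power2_eq_square)
  obtain n where n: "rep H (\<lambda>(_::unit) _. n)" "pairing n x = 1" "pairing n y = 1" "pairing n z = 1"
    using character_exists[of 1 1] by auto
  obtain c where c: "rep H (\<lambda>(_::unit) _. c)" "pairing c x = 1" "pairing c y = 1" "pairing c z = -1"
    using character_exists[of 1 "-1"] by auto
  obtain a where a: "rep H (\<lambda>(_::unit) _. a)" "pairing a x = -1" "pairing a y = -1" "pairing a z = \<iota>"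
    using character_exists[of "-1" \<iota>] \<iota> by auto
  obtain b where b: "rep H (\<lambda>(_::unit) _. b)" "pairing b x = -1" "pairing b y = -1" "pairing b z = -\<iota>"
    using character_exists[of "-1" "-\<iota>"] \<iota> by auto
  obtain \<sigma> where \<sigma>: "rep H \<sigma>"
    "\<And>i j. pairing (\<sigma> i j) x = (if i = j then if i then 1 else -1 else 0)"
    "\<And>i j. pairing (\<sigma> i j) y = (if i = j then if i then -1 else 1 else 0)"
    "\<And>i j. pairing (\<sigma> i j) z = (if i = j then 0 else 1)"
    using standard_rep_exists by blast
  have ch: "pairing n (r m) = 0" "pairing c (r m) = 0" "pairing a (r m) = 0" "pairing b (r m) = 0"
    if "snd m \<noteq> Q1" for m
    using that n c a b \<iota> by (auto intro!: character_r_eq_0 character_square)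
  \<comment> \<open>The trivial character is produced as \<open>n\<close>, so that the vanishing
    shown for characters covers the counit too.\<close>
  have "n = covector (counit H)"
    using rep_ext[OF n(1) rep_counit] n by (simp add: counit_x counit_y counit_z fun_eq_iff)
  note ch(1)[unfolded this, simplified]
  note square = standard_rep_square[OF \<sigma> \<iota> c a b]
  have \<sigma>0: "pairing (\<sigma> i j) (r g) = 0" for i j
  proof (rule standard_rep_r_eq_0[OF \<sigma>(1) _ _ _ _ g])
    show "pairing (tensor_rep H \<sigma> \<sigma> p q) (r m) = 0" if "snd m \<noteq> Q1" for m p q
      using ch[OF that] \<open>snd m \<noteq> Q1 \<Longrightarrow> counit H (r m) = 0\<close>[OF that]
      by (cases p; cases q) (simp add: square)
  qed (simp_all add: square r_counit)
  \<comment> \<open>Joint faithfulness: four characters and four matrix entries give eight linear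
    equations, which separate into one system for \<open>c1\<close> to \<open>c4\<close> and one for
    \<open>d1\<close> to \<open>d4\<close>.\<close>
  have inj: "h = 0" if "pairing n h = 0" "pairing c h = 0" "pairing a h = 0" "pairing b h = 0"
    "\<And>i j. pairing (\<sigma> i j) h = 0" for h
  proof -
    obtain c1 c2 c3 c4 d1 d2 d3 d4 where h: "h = c1 *s e + c2 *s x + c3 *s y + c4 *s (x \<odot> y)
       + d1 *s z + d2 *s (x \<odot> z) + d3 *s (y \<odot> z) + d4 *s (x \<odot> (y \<odot> z))"
      by (rule basis_expansion_h8)
    note vals = h character_mult[OF n(1)] character_mult[OF c(1)] character_mult[OF a(1)]
      character_mult[OF b(1)] character_unit[OF n(1)] character_unit[OF c(1)]
      character_unit[OF a(1)] character_unit[OF b(1)] n c a b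
    have "pairing n h = c1 + c2 + c3 + c4 + (d1 + d2 + d3 + d4)"
      "pairing c h = c1 + c2 + c3 + c4 - (d1 + d2 + d3 + d4)"
      by (simp_all add: vals algebra_simps)
    note nc = this[unfolded that, symmetric]
    have "pairing a h = c1 - c2 - c3 + c4 + \<iota> * (d1 - d2 - d3 + d4)"
      "pairing b h = c1 - c2 - c3 + c4 - \<iota> * (d1 - d2 - d3 + d4)"
      by (simp_all add: vals algebra_simps)
    note ab = this[unfolded that, symmetric]
    have "pairing (\<sigma> True True) h = c1 + c2 - c3 - c4"
      "pairing (\<sigma> False False) h = c1 - c2 + c3 - c4"
      "pairing (\<sigma> True False) h = d1 + d2 - d3 - d4"
      "pairing (\<sigma> False True) h = d1 - d2 + d3 - d4"
      by (simp_all add: h rep_mult[OF \<sigma>(1)] rep_unit[OF \<sigma>(1)] \<sigma> UNIV_bool algebra_simps)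
    note s = this[unfolded that, symmetric]
    have split: "t = 0" "w = 0" if "t + w = 0" "t - w = 0" for t w :: 'k
    proof -
      have "2 * t = (t + w) + (t - w)" "2 * w = (t + w) - (t - w)" by simp_all
      then show "t = 0" "w = 0" unfolding that by simp_all
    qed
    have "\<iota> \<noteq> 0" using \<iota> by auto
    then have d': "d1 - d2 - d3 + d4 = 0" using split(2)[OF ab] by simp
    \<comment> \<open>The sign matrix is inverted by its transpose up to the factor 4, nonzero in
      characteristic zero.\<close>
    have solve: "t1 = 0 \<and> t2 = 0 \<and> t3 = 0 \<and> t4 = 0"
      if "t1 + t2 + t3 + t4 = 0" "t1 - t2 - t3 + t4 = 0" "t1 + t2 - t3 - t4 = 0"
        "t1 - t2 + t3 - t4 = 0" for t1 t2 t3 t4 :: 'k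
    proof -
      have "4 * t1 = (t1 + t2 + t3 + t4) + (t1 - t2 - t3 + t4) + (t1 + t2 - t3 - t4) + (t1 - t2 + t3 - t4)"
        "4 * t2 = (t1 + t2 + t3 + t4) - (t1 - t2 - t3 + t4) + (t1 + t2 - t3 - t4) - (t1 - t2 + t3 - t4)"
        "4 * t3 = (t1 + t2 + t3 + t4) - (t1 - t2 - t3 + t4) - (t1 + t2 - t3 - t4) + (t1 - t2 + t3 - t4)"
        "4 * t4 = (t1 + t2 + t3 + t4) + (t1 - t2 - t3 + t4) - (t1 + t2 - t3 - t4) - (t1 - t2 + t3 - t4)"
        by simp_all
      then show ?thesis unfolding that by simp
    qed
    have "c1 = 0 \<and> c2 = 0 \<and> c3 = 0 \<and> c4 = 0" "d1 = 0 \<and> d2 = 0 \<and> d3 = 0 \<and> d4 = 0"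
      using solve[OF split(1)[OF nc] split(1)[OF ab] s(1,2)] solve[OF split(2)[OF nc] d' s(3,4)]
      by blast+
    then show ?thesis by (simp add: h)
  qed
  show ?thesis by (rule inj) (simp_all add: ch[OF g] \<sigma>0)
qed

end

section \<open>Hopf algebra maps from the double to a group algebra\<close>

lemma covector_add: "covector (\<lambda>a. \<phi> a + \<psi> a) = covector \<phi> + covector \<psi>"
  and covector_scale: "covector (\<lambda>a. k * \<phi> a) = k *s covector \<phi>"
  by (simp_all add: covector_def vec_eq_iff)

lemma group_algebra_mult_nth:
  "hmult (group_algebra G) a b $ g = (\<Sum>c\<in>UNIV. \<Sum>d\<in>UNIV. if c \<otimes>\<^bsub>G\<^esub> d = g then a $ c * b $ d else 0)"
  by (auto simp: group_algebra_def axis_def intro!: sum.cong)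

lemma group_algebra_comult_nth:
  "comult (group_algebra G) a $ (g, h) = (if g = h then a $ g else 0)"
proof -
  have "comult (group_algebra G) a $ (g, h) = (\<Sum>c\<in>UNIV. a $ c * (axis c 1 $ g * axis c 1 $ h))"
    by (simp add: group_algebra_def)
  also have "\<dots> = (\<Sum>c\<in>UNIV. if c = g then if g = h then a $ g else 0 else 0)"
    by (rule sum.cong) (auto simp: axis_def)
  finally show ?thesis by simp
qed

text \<open>A diagonal coproduct makes the coefficients of \<open>a\<close> orthogonal idempotents;
  the counit makes one of them nonzero, hence 1, and the others vanish.\<close>

lemma group_algebra_grouplike:
  assumes a: "comult (group_algebra G) a = tensor a a" "counit (group_algebra G) a = 1"
  obtains g where "a = axis g 1"
proof -
  have orth: "a $ g * a $ h = (if g = h then a $ g else 0)" for g h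
    by (metis a(1) group_algebra_comult_nth tensor_nth)
  have "(\<Sum>g\<in>UNIV. a $ g) = 1" using a(2) by (simp add: group_algebra_def)
  then obtain g where g: "a $ g \<noteq> 0" by (metis sum.neutral zero_neq_one)
  have "a $ h = axis g 1 $ h" for h
    using orth[of g h] g by (auto simp: axis_def split: if_splits)
  then show thesis by (intro that[of g]) (simp add: vec_eq_iff)
qed

locale bijective_antipode = hopf_algebra H
  for H :: "('k::field, 'i::finite) hopf" +
  assumes antipode_bij: "bij (antipode H)"
begin

abbreviation "\<epsilon> \<equiv> covector (counit H)"
abbreviation "iS \<equiv> inv_into UNIV (antipode H)"

lemma lin_iS: "lin iS"
  by (rule vec.inj_linear_imp_inv_linear[OF linear_antipode bij_is_inj[OF antipode_bij]])

lemma iS_simps [simp]: "iS (a + b) = iS a + iS b" "iS (k *s a) = k *s iS a"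
  by (rule lin_add[OF lin_iS] lin_scale[OF lin_iS])+

lemma iS_unit: "iS (hunit H) = hunit H"
proof -
  have "bilin (\<lambda>b c. hmult H (antipode H b) c)"
    by (rule bilinI) simp_all
  from tlift_tensor[OF this] have "antipode H (hunit H) = hunit H"
    using antipode_left[of "hunit H"] by (simp add: comult_unit counit_unit)
  then show ?thesis
    using antipode_bij by (metis bij_is_inj inv_f_f)
qed

lemma counit_antipode: "counit H (antipode H a) = counit H a"
proof -
  have "counit H (tlift (\<lambda>b c. hmult H (antipode H b) c) t)
      = counit H (antipode H (tlift (\<lambda>b c. counit H c *s b) t))" for t
  proof (induction t rule: tensor_induct)
    case zero
    show ?case by (simp add: lin_zero[OF tlift_lin] lin_zero[OF linear_antipode])
  next
    case (tensor b c)
    have "bilin (\<lambda>b c. hmult H (antipode H b) c)" "bilin (\<lambda>(b :: 'k ^ 'i) c. counit H c *s b)"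
      by (rule bilinI; simp add: vec.scale_right_distrib vec.scale_left_distrib mult.commute)+
    from this[THEN tlift_tensor] show ?case by (simp add: counit_mult)
  qed simp_all
  from this[of "comult H a"] show ?thesis
    by (simp add: antipode_left counit_right counit_unit)
qed

lemma counit_iS [simp]: "counit H (iS a) = counit H a"
  by (metis antipode_bij bij_is_surj counit_antipode surj_f_inv_f)

lemma double_mult_simps [simp]:
  "double_mult H (f + f') h g l = double_mult H f h g l + double_mult H f' h g l"
  "double_mult H f (h + h') g l = double_mult H f h g l + double_mult H f h' g l"
  "double_mult H f h (g + g') l = double_mult H f h g l + double_mult H f h g' l"
  "double_mult H f h g (l + l') = double_mult H f h g l + double_mult H f h g l'"
  "double_mult H (k *s f) h g l = k *s double_mult H f h g l"
  "double_mult H f (k *s h) g l = k *s double_mult H f h g l"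
  "double_mult H f h (k *s g) l = k *s double_mult H f h g l"
  "double_mult H f h g (k *s l) = k *s double_mult H f h g l"
  by (simp_all add: double_mult_def tlift_add_fun tlift_scale_fun covector_add covector_scale)

lemma double_mult_tensor:
  "hmult (drinfeld_double H) (tensor f h) (tensor g l) = double_mult H f h g l"
proof -
  have "bilin (double_mult H f h)" for f h
    by (rule bilinI) simp_all
  note 1 = tlift_tensor[OF this]
  have "bilin (\<lambda>f h. tlift (double_mult H f h) t)" for t
    by (rule bilinI) (simp_all add: tlift_def vec.scale_right_distrib sum.distrib
        vec.scale_sum_right mult.commute)
  from tlift_tensor[OF this] show ?thesis
    by (simp add: drinfeld_double_def Let_def 1)
qed

text \<open>The twofold coproduct of the unit is a pure tensor of units, so \<open>g\<close> is not
  twisted. This yields both the product on the dual and the factorization of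
  \<open>tensor f h\<close> into its two legs.\<close>

lemma double_mult_unit: "double_mult H f (hunit H) g l = tensor (hmult (dual_hopf H) f g) l"
proof -
  let ?\<beta> = "\<lambda>h1 h2 h3. tensor (hmult (dual_hopf H) f
      (covector (\<lambda>a. pairing g (hmult H (hmult H (iS h3) a) h1)))) (hmult H h2 l)"
  have "bilin (?\<beta> h1)" for h1
    by (rule bilinI) (simp_all add: covector_add covector_scale)
  note 1 = tlift_tensor[OF this]
  have "bilin (\<lambda>h1 h23. tlift (?\<beta> h1) (comult H h23))"
    by (rule bilinI) (simp_all add: tlift_add_fun tlift_scale_fun covector_add covector_scale)
  note 2 = tlift_tensor[OF this]
  have "double_mult H f (hunit H) g l = ?\<beta> (hunit H) (hunit H) (hunit H)"
    by (simp only: double_mult_def comult_unit 1 2)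
  then show ?thesis by (simp add: iS_unit)
qed

text \<open>The counit is multiplicative and invariant under \<open>iS\<close>, so twisting
  \<open>\<epsilon>\<close> only produces the scalars \<open>counit H h1\<close> and
  \<open>counit H h3\<close>, which the counit axioms absorb.\<close>

lemma double_mult_counit: "double_mult H \<epsilon> h \<epsilon> l = tensor \<epsilon> (hmult H h l)"
proof -
  have lin_tensor: "lin (\<lambda>b. tensor \<epsilon> (hmult H b l))"
    by (rule linI) simp_all
  have "double_mult H \<epsilon> h \<epsilon> l = tlift (\<lambda>h1 h23. tlift (\<lambda>h2 h3.
      counit H h1 *s tensor \<epsilon> (hmult H (counit H h3 *s h2) l)) (comult H h23)) (comult H h)"
    by (simp add: double_mult_def counit_mult covector_scale mult_ac)
  also have "\<dots> = tlift (\<lambda>h1 h23. counit H h1 *s tensor \<epsilon> (hmult H h23 l)) (comult H h)"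
    unfolding tlift_scale_fun lin_tlift[OF lin_tensor, symmetric] counit_right ..
  also have "\<dots> = tlift (\<lambda>h1 h23. tensor \<epsilon> (hmult H (counit H h1 *s h23) l)) (comult H h)"
    by simp
  also have "\<dots> = tensor \<epsilon> (hmult H h l)"
    unfolding lin_tlift[OF lin_tensor, symmetric] counit_left ..
  finally show ?thesis .
qed

lemma cop_dual_comult_nth:
  "comult (cop_hopf (dual_hopf H)) f $ (i, j) = pairing f (hmult H (axis j 1) (axis i 1))"
  by (simp add: cop_hopf_def dual_hopf_def)

lemma double_comult_tensor:
  "comult (drinfeld_double H) (tensor f h) = tlift (\<lambda>f1 f2. tlift (\<lambda>h1 h2.
    tensor (tensor f1 h1) (tensor f2 h2)) (comult H h)) (comult (cop_hopf (dual_hopf H)) f)"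
proof -
  let ?A = "cop_hopf (dual_hopf H)"
  have A: "comult ?A (f + f') = comult ?A f + comult ?A f'" "comult ?A (k *s f) = k *s comult ?A f"
    for f f' k
    by (auto simp: vec_eq_iff cop_dual_comult_nth)
  have "bilin (\<lambda>f h. tlift (\<lambda>f1 f2. tlift (\<lambda>h1 h2.
      tensor (tensor f1 h1) (tensor f2 h2)) (comult H h)) (comult ?A f))"
    by (rule bilinI) (simp_all add: A tlift_add_fun tlift_scale_fun)
  from tlift_tensor[OF this] show ?thesis by (simp add: drinfeld_double_def Let_def)
qed

lemma double_counit_tensor:
  "counit (drinfeld_double H) (tensor f h) = pairing f (hunit H) * counit H h"
  by (simp add: drinfeld_double_def Let_def cop_hopf_def dual_hopf_def pairing_def sum_product
      linear_form_expand[OF linear_counit, of h] mult_ac)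
   (simp add: axis_def if_distrib if_distribR mult_ac cong: if_cong)

end

locale double_to_group_algebra = bijective_antipode H
  for H :: "('k::field, 'i::finite) hopf" +
  fixes G :: "'g::finite monoid" and p :: "'k ^ ('i \<times> 'i) \<Rightarrow> 'k ^ 'g"
  assumes hom: "hopf_hom (drinfeld_double H) (group_algebra G) p"
begin

definition "\<rho> f = p (tensor f (hunit H))"
definition "\<pi> h = p (tensor \<epsilon> h)"

lemma lin_p: "lin p"
  and p_mult: "p (hmult (drinfeld_double H) a b) = hmult (group_algebra G) (p a) (p b)"
  and p_unit: "p (hunit (drinfeld_double H)) = hunit (group_algebra G)"
  and p_comult: "comult (group_algebra G) (p a) = tlift (\<lambda>b c. tensor (p b) (p c)) (comult (drinfeld_double H) a)"
  and p_counit: "counit (group_algebra G) (p a) = counit (drinfeld_double H) a"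
  using hom by (simp_all add: hopf_hom_def)

lemma p_simps [simp]: "p (a + b) = p a + p b" "p (k *s a) = k *s p a"
  by (rule lin_add[OF lin_p] lin_scale[OF lin_p])+

lemma \<pi>_simps [simp]: "\<pi> (a + b) = \<pi> a + \<pi> b" "\<pi> (k *s a) = k *s \<pi> a"
  by (simp_all add: \<pi>_def)

lemma p_tensor: "p (tensor f h) = hmult (group_algebra G) (\<rho> f) (\<pi> h)"
  by (simp add: \<rho>_def \<pi>_def p_mult[symmetric] double_mult_tensor double_mult_unit)

lemma \<rho>_mult: "\<rho> (hmult (dual_hopf H) f g) = hmult (group_algebra G) (\<rho> f) (\<rho> g)"
  by (simp add: \<rho>_def p_mult[symmetric] double_mult_tensor double_mult_unit)

lemma \<pi>_mult: "\<pi> (hmult H h l) = hmult (group_algebra G) (\<pi> h) (\<pi> l)"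
  by (simp add: \<pi>_def p_mult[symmetric] double_mult_tensor double_mult_counit)

lemma \<pi>_unit: "\<pi> (hunit H) = hunit (group_algebra G)"
  and \<rho>_unit: "\<rho> \<epsilon> = hunit (group_algebra G)"
  using p_unit by (simp_all add: \<pi>_def \<rho>_def drinfeld_double_def Let_def cop_hopf_def dual_hopf_def)

lemma \<pi>_counit: "counit (group_algebra G) (\<pi> h) = counit H h"
  by (simp add: \<pi>_def p_counit double_counit_tensor counit_unit)

lemma \<rho>_counit: "counit (group_algebra G) (\<rho> f) = pairing f (hunit H)"
  by (simp add: \<rho>_def p_counit double_counit_tensor counit_unit)

lemma tlift_p_tensor: "tlift (\<lambda>b c. tensor (p b) (p c)) (tensor a b) = tensor (p a) (p b)"
  by (rule tlift_tensor, rule bilinI) simp_all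

lemma \<pi>_comult: "comult (group_algebra G) (\<pi> h) = tlift (\<lambda>a b. tensor (\<pi> a) (\<pi> b)) (comult H h)"
proof -
  have c: "comult (cop_hopf (dual_hopf H)) \<epsilon> = tensor \<epsilon> \<epsilon>"
    by (auto simp: vec_eq_iff cop_dual_comult_nth counit_mult) (simp add: covector_def)
  have "bilin (\<lambda>(f1 :: 'k ^ 'i) (f2 :: 'k ^ 'i).
      tlift (\<lambda>h1 h2. tensor (tensor f1 h1) (tensor f2 h2)) (comult H h))"
    by (rule bilinI) (simp_all add: tlift_add_fun tlift_scale_fun)
  note 1 = tlift_tensor[OF this]
  show ?thesis
    by (simp add: \<pi>_def p_comult double_comult_tensor c 1 lin_tlift[OF tlift_lin] tlift_p_tensor)
qed

text \<open>The coefficient of \<open>\<rho> f\<close> at \<open>g\<close> is linear in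
  \<open>f\<close>, hence is evaluation at an element of \<open>H\<close>; its coordinates are read
  off on the dual basis.\<close>

definition "r g = (\<chi> i. \<rho> (axis i 1) $ g)"

lemma \<rho>_nth: "\<rho> f $ g = pairing f (r g)"
proof -
  have "lin \<rho>" by (rule linI) (simp_all add: \<rho>_def)
  from lin_expand[OF this, of f] show ?thesis by (simp add: pairing_def r_def)
qed

text \<open>The group algebra has a diagonal coproduct, while the co-opposite dual has the reversed
  dual of multiplication; comparing coefficients at \<open>(h, g)\<close> gives the law. Likewise
  \<open>r_sum\<close>, \<open>r_counit\<close> and \<open>r_comult\<close> are dual to
  compatibility of \<open>\<rho>\<close> with counit, unit and product.\<close>

lemma r_mult: "hmult H (r g) (r h) = (if g = h then r g else 0)"
proof (rule pairing_eqI)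
  fix f
  have "bilin (\<lambda>(h1 :: 'k ^ 'i) (h2 :: 'k ^ 'i). tensor (tensor f1 h1) (tensor f2 h2))"
    for f1 f2 :: "'k ^ 'i"
    by (rule bilinI) simp_all
  note 1 = tlift_tensor[OF this]
  have "comult (group_algebra G) (\<rho> f) $ (h, g) =
      (\<Sum>i\<in>UNIV. \<Sum>j\<in>UNIV. pairing f (hmult H (axis j 1) (axis i 1)) * (r h $ i * r g $ j))"
    unfolding \<rho>_def p_comult double_comult_tensor comult_unit 1 lin_tlift[OF tlift_lin] tlift_p_tensor
    by (simp add: tlift_nth cop_dual_comult_nth r_def \<rho>_def)
  also have "\<dots> = (\<Sum>j\<in>UNIV. \<Sum>i\<in>UNIV. r g $ j * (r h $ i * pairing f (hmult H (axis j 1) (axis i 1))))"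
    by (subst sum.swap) (simp add: mult_ac)
  also have "\<dots> = pairing f (hmult H (r g) (r h))"
    unfolding lin_expand[OF lin_mult_left, of "r g"]
    by (subst lin_expand[OF lin_mult_right, of _ "r h"]) (simp add: pairing_sum sum_distrib_left)
  finally show "pairing f (hmult H (r g) (r h)) = pairing f (if g = h then r g else 0)"
    by (auto simp: group_algebra_comult_nth \<rho>_nth split: if_splits)
qed

lemma r_sum: "(\<Sum>g\<in>UNIV. r g) = hunit H"
proof (rule pairing_eqI)
  show "pairing f (\<Sum>g\<in>UNIV. r g) = pairing f (hunit H)" for f
    using \<rho>_counit[of f] by (simp add: pairing_sum \<rho>_nth group_algebra_def)
qed

lemma r_counit: "counit H (r g) = (if g = \<one>\<^bsub>G\<^esub> then 1 else 0)"
  using \<rho>_nth[of \<epsilon> g] by (simp add: \<rho>_unit group_algebra_def axis_def)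

lemma r_comult: "pairing (tensor f f') (comult H (r g)) =
    (\<Sum>a\<in>UNIV. \<Sum>b\<in>UNIV. if a \<otimes>\<^bsub>G\<^esub> b = g then pairing f (r a) * pairing f' (r b) else 0)"
  using \<rho>_nth[of "hmult (dual_hopf H) f f'" g]
  by (simp add: \<rho>_mult group_algebra_mult_nth \<rho>_nth pairing_dual_mult cong: if_cong)

end

section \<open>Images in the group algebra of the quaternion group\<close>

definition central_support :: "'k::field ^ q8 \<Rightarrow> bool" where
  "central_support a \<longleftrightarrow> (\<forall>g. snd g \<noteq> Q1 \<longrightarrow> a $ g = 0)"

lemma central_support_add: "central_support a \<Longrightarrow> central_support b \<Longrightarrow> central_support (a + b)"
  and central_support_scale: "central_support a \<Longrightarrow> central_support (k *s a)"
  by (auto simp: central_support_def)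

lemma central_support_axis: "central_support (axis g 1) \<longleftrightarrow> snd g = Q1"
  by (cases g) (auto simp: central_support_def axis_def)

lemma Q8_simps [simp]: "g \<otimes>\<^bsub>Q8\<^esub> h = q8_mult g h" "\<one>\<^bsub>Q8\<^esub> = (False, Q1)"
  by (simp_all add: Q8_def)

lemma central_support_mult:
  assumes "central_support a" "central_support b"
  shows "central_support (hmult (group_algebra Q8) a b)"
  unfolding central_support_def group_algebra_mult_nth
proof (intro allI impI sum.neutral ballI)
  fix g c d :: q8
  assume "snd g \<noteq> Q1"
  then have "q8_mult c d = g \<Longrightarrow> snd c \<noteq> Q1 \<or> snd d \<noteq> Q1"
    by (auto simp: q8_mult_def Let_def)
  then show "(if c \<otimes>\<^bsub>Q8\<^esub> d = g then a $ c * b $ d else 0) = 0"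
    using assms by (metis central_support_def Q8_simps(1) mult_zero_left mult_zero_right)
qed

lemma group_algebra_mult_axis:
  "hmult (group_algebra G) (axis g 1) (axis h 1) = axis (g \<otimes>\<^bsub>G\<^esub> h) 1"
  unfolding vec_eq_iff
proof (rule allI)
  fix l
  have "hmult (group_algebra G) (axis g 1) (axis h 1) $ l
      = (\<Sum>c\<in>UNIV. \<Sum>d\<in>UNIV. if d = h then if c = g then axis (g \<otimes>\<^bsub>G\<^esub> h) 1 $ l else 0 else 0)"
    unfolding group_algebra_mult_nth by (intro sum.cong refl) (auto simp: axis_def)
  then show "hmult (group_algebra G) (axis g 1) (axis h 1) $ l = axis (g \<otimes>\<^bsub>G\<^esub> h) 1 $ l"
    by simp
qed

text \<open>Translation by the central element \<open>(s, Q1)\<close>, through which the images of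
  \<open>x\<close> and \<open>y\<close> act on coefficients.\<close>

definition flip_sign :: "bool \<Rightarrow> q8 \<Rightarrow> q8" where
  "flip_sign s g = (fst g \<noteq> s, snd g)"

lemma mult_axis_sign:
  "hmult (group_algebra Q8) (axis (s, Q1) 1) c $ g = c $ flip_sign s g"
  "hmult (group_algebra Q8) c (axis (s, Q1) 1) $ g = c $ flip_sign s g"
  by (cases g; cases "snd g"; cases s; cases "fst g";
      simp add: group_algebra_mult_nth sum_q8 q8_mult_def Let_def axis_def flip_sign_def)+

text \<open>This is meant for \<open>c\<close> the image of \<open>z\<close>, with \<open>s\<close>
  and \<open>t\<close> the signs of the images of \<open>x\<close> and \<open>y\<close>. The
  hypotheses are twice the coproduct of \<open>z\<close> in coordinates, the relation
  \<open>z x = y z\<close>, and the relation for the square of \<open>z\<close>.\<close>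

lemma skew_grouplike_central_support:
  fixes c :: "'k::field_char_0 ^ q8"
  assumes coprod: "\<And>a b. (if a = b then 2 * c $ a else 0) = c $ a * c $ b + c $ flip_sign t a * c $ b
      + c $ a * c $ flip_sign s b - c $ flip_sign t a * c $ flip_sign s b"
    and comm: "\<And>a. c $ flip_sign s a = c $ flip_sign t a"
    and sq: "hmult (group_algebra Q8) c c = (1 / 2) *s (axis (False, Q1) 1 + axis (s, Q1) 1
      + axis (t, Q1) 1 - axis (s \<noteq> t, Q1) 1)"
  shows "central_support c"
  unfolding central_support_def
proof (intro allI impI)
  fix g :: q8 assume g: "snd g \<noteq> Q1"
  let ?C = "\<lambda>b u. c $ (b, u)" and ?P = "c $ (False, Q1)" and ?Q = "c $ (True, Q1)"
  let ?m = "hmult (group_algebra Q8) c c"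
  have coeff: "?m $ (False, Q1) = ?P * ?P + ?Q * ?Q
      + 2 * (?C False Qi * ?C True Qi + ?C False Qj * ?C True Qj + ?C False Qk * ?C True Qk)"
    "?m $ (True, Q1) = 2 * (?P * ?Q)
      + (?C False Qi * ?C False Qi + ?C True Qi * ?C True Qi
      + (?C False Qj * ?C False Qj + ?C True Qj * ?C True Qj)
      + (?C False Qk * ?C False Qk + ?C True Qk * ?C True Qk))"
    by (simp_all add: group_algebra_mult_nth sum_q8 q8_mult_def Let_def algebra_simps)
  have flip: "flip_sign False a = a" "flip_sign True (b, u) = (\<not> b, u)" for a b u
    by (simp_all add: flip_sign_def)
  consider "\<not> s" "\<not> t" | "s \<noteq> t" | "s" "t" by blast
  then show "c $ g = 0"
  proof cases
    \<comment> \<open>With both signs trivial the coefficients are orthogonal, so the square of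
      \<open>c\<close> has coefficient \<open>?P * ?P + ?Q * ?Q = 1\<close> at 1; multiplying by
      \<open>c $ g\<close> gives 0.\<close>
    case 1
    have orth: "c $ a * c $ b = 0" if "a \<noteq> b" for a b
      using coprod[of a b] that 1 by (simp add: flip)
    have "?P * ?P + ?Q * ?Q = 1"
      using arg_cong[OF sq, of "\<lambda>a. a $ (False, Q1)"] 1 unfolding coeff by (simp add: orth axis_def)
    then have "c $ g = c $ g * (?P * ?P + ?Q * ?Q)" by simp
    also have "\<dots> = (c $ g * ?P) * ?P + (c $ g * ?Q) * ?Q" by (simp add: algebra_simps)
    also have "\<dots> = 0" using g by (simp add: orth prod_eq_iff)
    finally show ?thesis .
  next
    \<comment> \<open>Here \<open>comm\<close> makes \<open>c\<close> invariant under the sign flip,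
      and \<open>coprod\<close> at \<open>g\<close> and its negative says that the square of
      \<open>c $ g\<close> is 0.\<close>
    case 2
    have inv: "c $ (\<not> b, u) = c $ (b, u)" for b u
      using comm[of "(b, u)"] 2 by (cases s; cases t) (simp_all add: flip)
    then have inv': "c $ flip_sign w a = c $ a" for w a
      by (cases w; cases a) (simp_all add: flip)
    have "2 * (c $ g * c $ (\<not> fst g, snd g)) = 0"
      using coprod[of g "(\<not> fst g, snd g)"] by (simp add: inv' prod_eq_iff)
    then show ?thesis by (simp add: inv)
  next
    \<comment> \<open>Now the squares of the coefficients cancel in pairs, leaving
      \<open>2 * (?P * ?Q) = 1\<close> at -1, and coefficients at different units are
      orthogonal.\<close>
    case 3
    have rel: "(if (p, u) = (q, w) then 2 * ?C p u else 0) = ?C p u * ?C q w + ?C (\<not> p) u * ?C q w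
      + ?C p u * ?C (\<not> q) w - ?C (\<not> p) u * ?C (\<not> q) w" for p q u w
      using coprod[of "(p, u)" "(q, w)"] 3 by (simp add: flip)
    have square: "?C False u * ?C False u + ?C True u * ?C True u = 0" for u
      using rel[of False u True u] by (simp add: mult.commute add.commute)
    have orth: "?C p u * ?C q w = 0" if "u \<noteq> w" for p q u w
    proof -
      let ?R = "\<lambda>p q. ?C p u * ?C q w + ?C (\<not> p) u * ?C q w + ?C p u * ?C (\<not> q) w
        - ?C (\<not> p) u * ?C (\<not> q) w"
      have R: "?R p q = 0" for p q
        unfolding rel[symmetric] using that by simp
      \<comment> \<open>For fixed units the four choices of signs form a linear system, which this
        combination inverts.\<close>
      have "4 * (?C p u * ?C q w) = ?R p q + ?R (\<not> p) q + ?R p (\<not> q) - ?R (\<not> p) (\<not> q)"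
        by (simp add: algebra_simps)
      then have "4 * (?C p u * ?C q w) = 0"
        unfolding R by simp
      then show ?thesis by simp
    qed
    have "2 * (?P * ?Q) = 1"
      using arg_cong[OF sq, of "\<lambda>a. a $ (True, Q1)"] 3 unfolding coeff square by (simp add: axis_def)
    then have "c $ g = 2 * (c $ g * ?P * ?Q)"
      by (metis mult.assoc mult.left_commute mult.right_neutral)
    also have "\<dots> = 0"
      using orth[of "snd g" Q1 "fst g" False] g by simp
    finally show ?thesis .
  qed
qed

lemma hopf_hom_comp:
  assumes f: "hopf_hom A B f" and g: "hopf_hom B C g"
  shows "hopf_hom A C (g \<circ> f)"
proof -
  have lin: "lin f" "lin g" using f g by (simp_all add: hopf_hom_def)
  have "bilin (\<lambda>b c. tensor (g b) (g c))"
    by (rule bilinI) (simp_all add: lin_add[OF lin(2)] lin_scale[OF lin(2)])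
  note tlift_tensor[OF this]
  then show ?thesis
    using f g Vector_Spaces.linear_compose[OF lin] by (simp add: hopf_hom_def lin_tlift[OF tlift_lin])
qed

section \<open>Maps from the double of the eight-dimensional algebra to \<open>kQ\<close>\<close>

sublocale h8 \<subseteq> bijective_antipode
  by unfold_locales (rule bij_antipode)

locale h8_double_map = h8 H v + double_to_group_algebra H Q8 p
  for H :: "('k::{alg_closed_field, field_char_0}, 'i::finite) hopf" and v p
begin

text \<open>Grouplikes go to group elements, and the only elements of \<open>Q8\<close> that square
  to 1 are \<open>\<plusminus>1\<close>.\<close>

lemma \<pi>_involution:
  assumes "comult H u = tensor u u" "counit H u = 1" "hmult H u u = hunit H"
  obtains s where "\<pi> u = axis (s, Q1) 1"
proof -
  have "tlift (\<lambda>a b. tensor (\<pi> a) (\<pi> b)) (tensor u u) = tensor (\<pi> u) (\<pi> u)"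
    by (rule tlift_tensor, rule bilinI) simp_all
  then obtain g where g: "\<pi> u = axis g 1"
    using group_algebra_grouplike[of Q8 "\<pi> u"] by (metis assms(1,2) \<pi>_comult \<pi>_counit)
  have "axis (q8_mult g g) 1 = (axis (False, Q1) 1 :: 'k ^ q8)"
    using \<pi>_mult[of u u] by (simp add: assms(3) \<pi>_unit g group_algebra_mult_axis) (simp add: group_algebra_def)
  then have "q8_mult g g = (False, Q1)" by (simp add: axis_eq_axis)
  then have "snd g = Q1" by (cases g; cases "snd g") (auto simp: q8_mult_def)
  then show thesis by (metis that g prod.collapse)
qed

lemma central_support_\<pi>: "central_support (\<pi> h)"
proof -
  let ?m = "hmult (group_algebra Q8)"
  obtain s where s: "\<pi> x = axis (s, Q1) 1"
    using \<pi>_involution comult_x counit_x relations(1) by metis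
  obtain t where t: "\<pi> y = axis (t, Q1) 1"
    using \<pi>_involution comult_y counit_y relations(2) by metis
  have \<pi>_diff: "\<pi> (a - b) = \<pi> a - \<pi> b" for a b
    by (rule lin_diff, rule linI) simp_all
  have one: "\<pi> e = axis (False, Q1) 1"
    by (simp add: \<pi>_unit) (simp add: group_algebra_def)
  have z: "central_support (\<pi> z)"
  proof (rule skew_grouplike_central_support)
    show "\<pi> z $ flip_sign s a = \<pi> z $ flip_sign t a" for a
      using arg_cong[OF relations(4), of "\<lambda>h. \<pi> h $ a"] by (simp add: \<pi>_mult s t mult_axis_sign)
    show "?m (\<pi> z) (\<pi> z) = (1 / 2) *s (axis (False, Q1) 1 + axis (s, Q1) 1
        + axis (t, Q1) 1 - axis (s \<noteq> t, Q1) 1)"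
      using arg_cong[OF relations(6), of \<pi>]
      by (simp add: \<pi>_mult s t one \<pi>_diff group_algebra_mult_axis q8_mult_def)
    have tl: "tlift (\<lambda>a b. tensor (\<pi> a) (\<pi> b)) (tensor a b) = tensor (\<pi> a) (\<pi> b)" for a b
      by (rule tlift_tensor, rule bilinI) simp_all
    show "(if a = b then 2 * \<pi> z $ a else 0) = \<pi> z $ a * \<pi> z $ b + \<pi> z $ flip_sign t a * \<pi> z $ b
      + \<pi> z $ a * \<pi> z $ flip_sign s b - \<pi> z $ flip_sign t a * \<pi> z $ flip_sign s b" for a b
    proof -
      have "comult (group_algebra Q8) (\<pi> z) $ (a, b) = (1 / 2) * (\<pi> z $ a * \<pi> z $ b
        + \<pi> z $ flip_sign t a * \<pi> z $ b
        + \<pi> z $ a * \<pi> z $ flip_sign s b - \<pi> z $ flip_sign t a * \<pi> z $ flip_sign s b)"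
        by (simp add: \<pi>_comult comult_z_expand lin_diff[OF tlift_lin] tl \<pi>_mult s t mult_axis_sign
            del: relations)
      then show ?thesis by (simp add: group_algebra_comult_nth mult.commute[of "2 :: 'k"] split: if_splits)
    qed
  qed
  have s': "central_support (\<pi> x)" "central_support (\<pi> y)" "central_support (\<pi> e)"
    by (simp_all add: s t one central_support_axis)
  obtain c1 c2 c3 c4 d1 d2 d3 d4 where h: "h = c1 *s e + c2 *s x + c3 *s y + c4 *s (x \<odot> y)
       + d1 *s z + d2 *s (x \<odot> z) + d3 *s (y \<odot> z) + d4 *s (x \<odot> (y \<odot> z))"
    by (rule basis_expansion_h8)
  show ?thesis
    unfolding h \<pi>_simps \<pi>_mult
    by (intro central_support_add central_support_scale central_support_mult s' z)
qed

lemma central_support_\<rho>: "central_support (\<rho> f)"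
proof -
  interpret R: h8_q8 H v r
    by unfold_locales (simp_all only: r_mult r_sum r_counit r_comult Q8_simps if_True refl)
  show ?thesis by (simp add: central_support_def \<rho>_nth R.r_eq_0)
qed

lemma central_support_p: "central_support (p t)"
proof (induction t rule: tensor_induct)
  case zero
  show ?case by (simp add: lin_zero[OF lin_p] central_support_def)
next
  case (tensor f h)
  show ?case by (simp add: p_tensor central_support_mult central_support_\<rho> central_support_\<pi>)
qed (simp_all add: central_support_add central_support_scale)

end

theorem theoremA1p2:
  fixes H :: "('k::{alg_closed_field, field_char_0}, 'i::finite) hopf"
  assumes "is_H8 H"
  shows "\<not> (\<exists>B :: ('k, 'j::finite) hopf.
            quotient_hopf_algebra (drinfeld_double H) B \<and>
            hopf_isomorphic B (group_algebra Q8))"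
proof
  assume "\<exists>B :: ('k, 'j::finite) hopf.
    quotient_hopf_algebra (drinfeld_double H) B \<and> hopf_isomorphic B (group_algebra Q8)"
  then obtain B :: "('k, 'j) hopf" and q f where
    q: "hopf_hom (drinfeld_double H) B q" "surj q" and f: "hopf_hom B (group_algebra Q8) f" "bij f"
    by (auto simp: quotient_hopf_algebra_def hopf_isomorphic_def)
  obtain v where "hopf_algebra H" and v: "presented_by H v h8_relations"
    "comult H (v Gx) = tensor (v Gx) (v Gx)" "comult H (v Gy) = tensor (v Gy) (v Gy)"
    "comult H (v Gz) = (1 / 2) *s tensor_mult H
      (tensor (hunit H + v Gy) (hunit H) + tensor (hunit H - v Gy) (v Gx)) (tensor (v Gz) (v Gz))"
    "counit H (v Gx) = 1" "counit H (v Gy) = 1" "counit H (v Gz) = 1"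
    using assms unfolding is_H8_def Let_def by blast
  interpret h8 H v
    using \<open>hopf_algebra H\<close> v by (intro h8.intro h8_axioms.intro)
  interpret h8_double_map H v "f \<circ> q"
    by unfold_locales (rule hopf_hom_comp[OF q(1) f(1)])
  have "surj (f \<circ> q)"
    by (rule comp_surj[OF q(2) bij_is_surj[OF f(2)]])
  \<comment> \<open>The quaternion \<open>i\<close> lies outside the center, so its basis vector
    cannot be in the image.\<close>
  then obtain t where "(f \<circ> q) t = axis (False, Qi) 1" by (metis surjD)
  with central_support_p[of t] show False by (simp add: central_support_axis)
qed

end
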